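(* Let $T:\mathbb T^2\to\mathbb T^2$ be $T(x,y)=(x+\alpha,\,y+f(x))$ where $\alpha$ is irrational and $f:\mathbb T\to\mathbb T$ is Lipschitz and homotopically non-trivial. Then for every Borel probability measure $\mu$ on $\mathbb T^2$ whose projection to the first coordinate is Lebesgue measure, and every $\varphi\in C(\mathbb T^2)$, $\lim_{n\to\infty}\int\varphi\circ T^n\,d\mu=\int\varphi\,dm$, where $m$ is Lebesgue measure on $\mathbb T^2$.
   Context: $\mathbb T=\mathbb R/\mathbb Z$. A map $\mathbb T\to\mathbb T$ is homotopically non-trivial if it has nonzero degree. *)

theory Defs
  imports "HOL-Probability.Probability"
begin

text \<open>The circle T = R/Z is modelled by real numbers modulo 1, with the fundamental
domain [0,1). A point of T^2 is represented by a pair in [0,1) x [0,1).\<close>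

definition tdist :: "real \<Rightarrow> real \<Rightarrow> real" where
  "tdist x y = \<bar>(x - y) - of_int (round (x - y))\<bar>"

text \<open>f : T -> T (given as a real function read modulo 1) is Lipschitz for the
torus metric. Note this also forces f to be well defined on R/Z.\<close>
definition circle_lipschitz :: "(real \<Rightarrow> real) \<Rightarrow> bool" where
  "circle_lipschitz f \<longleftrightarrow> (\<exists>L. \<forall>x y. tdist (f x) (f y) \<le> L * tdist x y)"

definition circle_degree :: "(real \<Rightarrow> real) \<Rightarrow> int \<Rightarrow> bool" where
  "circle_degree f d \<longleftrightarrow>
     (\<exists>F. continuous_on UNIV F \<and> (\<forall>x. F x - f x \<in> \<int>) \<and> F 1 - F 0 = of_int d)"

definition homotopically_nontrivial :: "(real \<Rightarrow> real) \<Rightarrow> bool" where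
  "homotopically_nontrivial f \<longleftrightarrow> (\<exists>d. d \<noteq> 0 \<and> circle_degree f d)"

definition skew :: "real \<Rightarrow> (real \<Rightarrow> real) \<Rightarrow> real \<times> real \<Rightarrow> real \<times> real" where
  "skew \<alpha> f p = (frac (fst p + \<alpha>), frac (snd p + f (fst p)))"

definition torus_continuous :: "(real \<times> real \<Rightarrow> real) \<Rightarrow> bool" where
  "torus_continuous \<phi> \<longleftrightarrow> continuous_on UNIV \<phi> \<and>
     (\<forall>x y. \<phi> (x + 1, y) = \<phi> (x, y) \<and> \<phi> (x, y + 1) = \<phi> (x, y))"

end

theory Submission
  imports Defs
begin

text \<open>
  Let F be a continuous lift of f; it is Lipschitz and satisfies F(x + 1) = F(x) + d with d \<noteq> 0.
  Write e(t) for the exponential exp(2 \<pi> i t) and S for the n-th Birkhoff sum of F, so that the n-th iterate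
  of the skew product is (x + n\<alpha>, y + S x). By density of trigonometric polynomials it is enough to
  treat the characters e(jx + ly), and the only difficult case is l \<noteq> 0.

  There S' / n is a Birkhoff average of F', so it converges to d in mean, and integrating by parts
  shows that c(n), the integral of e(lS) over the circle, tends to 0. Differentiability almost everywhere
  is avoided: F' is replaced by the dyadic difference quotients of F, which are Cauchy in mean square
  because each coarse quotient is an average of translates of a finer one, so that their norms
  approach a supremum and the parallelogram law applies.

  Finally, the functions e(lS) have stationary correlations c(m - n), which tend to 0. Hence a sum of K of them
  with sparse indices has norm about sqrt K, and by the Cauchy-Schwarz inequality the integrals of
  e(jx + ly) e(lS) against any measure with Lebesgue marginal cannot stay away from 0.
\<close>

section \<open>Continuous functions on the circle and the torus\<close>

text \<open>Functions on the circle are kept as 1-periodic functions on the whole line, so that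
  translation by an arbitrary real needs no reduction modulo 1. The codomain is general because real
  and complex functions both occur.\<close>

definition circle_continuous :: "(real \<Rightarrow> 'a::euclidean_space) \<Rightarrow> bool" where
  "circle_continuous v \<longleftrightarrow> continuous_on UNIV v \<and> (\<forall>x. v (x + 1) = v x)"

lemma circle_continuousD:
  assumes "circle_continuous v"
  shows "continuous_on S v" "v (x + 1) = v x"
  using assms continuous_on_subset by (auto simp: circle_continuous_def)

lemma circle_continuous_compose:
  assumes "circle_continuous v" "continuous_on UNIV g"
  shows "circle_continuous (\<lambda>x. g (v x))"
  using assms unfolding circle_continuous_def
  by (auto intro: continuous_on_compose2)

lemma circle_continuous_shift:
  assumes "circle_continuous v"
  shows "circle_continuous (\<lambda>x. v (x + t))"
proof -
  have "continuous_on UNIV (\<lambda>x. v (x + t))"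
    by (rule continuous_on_compose2[OF circle_continuousD(1)[OF assms, of UNIV]])
       (auto intro!: continuous_intros)
  moreover have "v (x + 1 + t) = v (x + t)" for x
    using circle_continuousD(2)[OF assms, of "x + t"] by (simp add: algebra_simps)
  ultimately show ?thesis
    by (auto simp: circle_continuous_def)
qed

lemma circle_continuous_integrable:
  "circle_continuous v \<Longrightarrow> v integrable_on {a..b}"
  using circle_continuousD(1) by (intro integrable_continuous_real)

lemma circle_continuous_const [simp]: "circle_continuous (\<lambda>x. c)"
  by (auto simp: circle_continuous_def)

lemma circle_continuous_add:
  "circle_continuous v \<Longrightarrow> circle_continuous w \<Longrightarrow> circle_continuous (\<lambda>x. v x + w x)"
  by (auto simp: circle_continuous_def intro!: continuous_intros)

lemma circle_continuous_diff:
  "circle_continuous v \<Longrightarrow> circle_continuous w \<Longrightarrow> circle_continuous (\<lambda>x. v x - w x)"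
  by (auto simp: circle_continuous_def intro!: continuous_intros)

lemma circle_continuous_sum:
  "(\<And>i. i \<in> I \<Longrightarrow> circle_continuous (v i)) \<Longrightarrow> circle_continuous (\<lambda>x. \<Sum>i\<in>I. v i x)"
  by (auto simp: circle_continuous_def intro!: continuous_intros)

lemma circle_continuous_mult:
  fixes v w :: "real \<Rightarrow> 'a::{euclidean_space, real_normed_algebra}"
  shows "circle_continuous v \<Longrightarrow> circle_continuous w \<Longrightarrow> circle_continuous (\<lambda>x. v x * w x)"
  by (auto simp: circle_continuous_def intro!: continuous_intros)

lemma circle_continuous_norm:
  "circle_continuous v \<Longrightarrow> circle_continuous (\<lambda>x. norm (v x))"
  by (auto simp: circle_continuous_def intro!: continuous_intros)

lemma circle_continuous_int_shift:
  assumes "circle_continuous v"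
  shows "v (x + of_int k) = v x"
proof -
  have nat: "v (y + of_nat n) = v y" for y n
  proof (induction n)
    case (Suc n)
    have "v (y + of_nat (Suc n)) = v ((y + of_nat n) + 1)" by (simp add: algebra_simps)
    then show ?case using Suc circle_continuousD(2)[OF assms, of "y + of_nat n"] by simp
  qed simp
  show ?thesis
  proof (cases "k \<ge> 0")
    case True
    then show ?thesis using nat[of x "nat k"] by simp
  next
    case False
    then show ?thesis using nat[of "x + of_int k" "nat (-k)"] by simp
  qed
qed

section \<open>Integration over one period\<close>

lemma integral_shift_interval:
  fixes v :: "real \<Rightarrow> 'a::euclidean_space"
  assumes "continuous_on UNIV v"
  shows "integral {a..b} (\<lambda>x. v (x + t)) = integral {a + t..b + t} v"
proof -
  have "v integrable_on {a + t..b + t}"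
    using assms continuous_on_subset by (blast intro: integrable_continuous_real)
  then have "(v has_integral integral {a + t..b + t} v) (cbox (a + t) (b + t))"
    by (simp add: has_integral_iff)
  from has_integral_affinity[OF this, of 1 t]
  show ?thesis by (auto intro!: integral_unique)
qed

text \<open>Only the fractional part of \<open>t\<close> matters, and the piece of the shifted
  interval that sticks out beyond 1 is moved back to the left end by periodicity.\<close>

lemma integral_circle_shift:
  assumes v: "circle_continuous v"
  shows "integral {0..1} (\<lambda>x. v (x + t)) = integral {0..1} v"
proof -
  note [simp] = circle_continuous_integrable[OF v]
  have cont: "continuous_on UNIV v" by (rule circle_continuousD[OF v])
  define s where "s = frac t"
  have s: "0 \<le> s" "s \<le> 1" unfolding s_def by (auto simp: frac_ge_0 frac_lt_1 less_imp_le)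
  have "v (x + t) = v (x + s)" for x
    using circle_continuous_int_shift[OF v, of "x + s" "\<lfloor>t\<rfloor>"]
    by (simp add: s_def frac_def algebra_simps)
  then have "integral {0..1} (\<lambda>x. v (x + t)) = integral {0..1} (\<lambda>x. v (x + s))" by simp
  also have "\<dots> = integral {s..1 + s} v"
    using integral_shift_interval[OF cont, of 0 1 s] by simp
  also have "\<dots> = integral {s..1} v + integral {1..1 + s} v"
    using s by (intro Henstock_Kurzweil_Integration.integral_combine[symmetric]) auto
  also have "integral {1..1 + s} v = integral {0..s} (\<lambda>x. v (x + 1))"
    using integral_shift_interval[OF cont, of 0 s 1] by (simp add: add.commute)
  also have "\<dots> = integral {0..s} v"
    using circle_continuousD(2)[OF v] by simp
  also have "integral {s..1} v + integral {0..s} v = integral {0..1} v"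
    using s by (subst add.commute) (intro Henstock_Kurzweil_Integration.integral_combine, auto)
  finally show ?thesis .
qed

section \<open>Characters of the circle, with \<open>circ t\<close> for e(t)\<close>

definition circ :: "real \<Rightarrow> complex" where
  "circ t = cis (2 * pi * t)"

lemma circ_add: "circ (s + t) = circ s * circ t"
  by (simp add: circ_def cis_mult distrib_left)

lemma norm_circ [simp]: "norm (circ t) = 1"
  by (simp add: circ_def)

lemma circ_0 [simp]: "circ 0 = 1"
  by (simp add: circ_def)

lemma cnj_circ: "cnj (circ t) = circ (- t)"
  by (simp add: circ_def cis_cnj)

lemma circ_Ints: "t \<in> \<int> \<Longrightarrow> circ t = 1"
  by (auto simp: circ_def elim!: Ints_cases)

lemma circ_eq_1_iff: "circ t = 1 \<longleftrightarrow> t \<in> \<int>"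
proof
  assume "circ t = 1"
  then have "cos (2 * pi * t) = 1" by (simp add: circ_def complex_eq_iff)
  then obtain n :: int where "2 * pi * t = of_int n * 2 * pi"
    using cos_one_2pi_int by auto
  then have "t = of_int n" by (simp add: field_simps)
  then show "t \<in> \<int>" by simp
qed (rule circ_Ints)

lemma circ_cong: "s - t \<in> \<int> \<Longrightarrow> circ s = circ t"
  using circ_add[of "s - t" t] circ_Ints[of "s - t"] by simp

lemma continuous_on_circ [continuous_intros]:
  "continuous_on S g \<Longrightarrow> continuous_on S (\<lambda>x. circ (g x))"
  unfolding circ_def by (intro continuous_intros)

text \<open>The quadratic error still tends to 0 after division by the step, which is what the
  integration by parts for Birkhoff sums relies on.\<close>

lemma circ_taylor: "cmod (circ t - 1 - 2 * pi * \<i> * t) \<le> 2 * pi\<^sup>2 * t\<^sup>2"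
  using iexp_approx1[of "2 * pi * t" 1]
  by (simp add: circ_def cis_conv_exp algebra_simps power2_eq_square)

lemma circle_continuous_circ: "circle_continuous (\<lambda>x. circ (of_int j * x))"
proof -
  have "circ (of_int j * (x + 1)) = circ (of_int j * x)" for x
    by (rule circ_cong) (simp add: algebra_simps)
  then show ?thesis
    by (auto simp: circle_continuous_def intro!: continuous_intros)
qed

text \<open>Translation by half a period of the character flips its sign but preserves the
  integral.\<close>

lemma integral_circ:
  assumes "j \<noteq> 0"
  shows "integral {0..1} (\<lambda>x. circ (of_int j * x)) = 0"
proof -
  define t :: real where "t = 1 / (2 * of_int j)"
  have t: "circ (of_int j * t) = -1"
    using assms by (simp add: t_def circ_def)
  have "integral {0..1} (\<lambda>x. circ (of_int j * x)) = integral {0..1} (\<lambda>x. circ (of_int j * (x + t)))"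
    by (rule integral_circle_shift[symmetric]) (rule circle_continuous_circ)
  also have "\<dots> = integral {0..1} (\<lambda>x. - circ (of_int j * x))"
    by (simp add: distrib_left circ_add t)
  finally show ?thesis
    by simp
qed

section \<open>Characters of the torus and trigonometric polynomials\<close>

definition torus_char :: "int \<Rightarrow> int \<Rightarrow> real \<times> real \<Rightarrow> complex" where
  "torus_char j l p = circ (of_int j * fst p + of_int l * snd p)"

lemma torus_char_mult: "torus_char j l p * torus_char j' l' p = torus_char (j + j') (l + l') p"
  by (simp add: torus_char_def circ_add[symmetric] algebra_simps)

lemma cnj_torus_char: "cnj (torus_char j l p) = torus_char (- j) (- l) p"
  by (simp add: torus_char_def cnj_circ algebra_simps)

lemma torus_char_split: "torus_char j l p = circ (of_int j * fst p) * circ (of_int l * snd p)"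
  by (simp add: torus_char_def circ_add)

lemma norm_torus_char [simp]: "norm (torus_char j l p) = 1"
  by (simp add: torus_char_def)

lemma continuous_on_torus_char [continuous_intros]:
  "continuous_on S g \<Longrightarrow> continuous_on S (\<lambda>x. torus_char j l (g x))"
  unfolding torus_char_def by (intro continuous_intros)

text \<open>Real parts keep the functions real valued, as the real Stone-Weierstrass theorem
  requires; a complex coefficient covers sines as well as cosines.\<close>

inductive trig_poly :: "(real \<times> real \<Rightarrow> real) \<Rightarrow> bool" where
  char: "trig_poly (\<lambda>p. Re (c * torus_char j l p))"
| add: "trig_poly f \<Longrightarrow> trig_poly g \<Longrightarrow> trig_poly (\<lambda>p. f p + g p)"

text \<open>Re a Re b = Re (a b / 2) + Re (a (cnj b) / 2), and the products of characters on the
  right are characters with added or subtracted frequencies.\<close>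

lemma trig_poly_mult:
  assumes "trig_poly f" "trig_poly g"
  shows "trig_poly (\<lambda>p. f p * g p)"
  using assms(1)
proof induction
  case (char c j l)
  show ?case using assms(2)
  proof induction
    case (char c' j' l')
    have "Re (c * torus_char j l p) * Re (c' * torus_char j' l' p) =
      Re (c * c' / 2 * torus_char (j + j') (l + l') p) +
      Re (c * cnj c' / 2 * torus_char (j + - j') (l + - l') p)" for p
    proof -
      have *: "Re a * Re b = Re (a * b / 2) + Re (a * cnj b / 2)" for a b
        by (simp add: field_simps)
      show ?thesis
        unfolding *[of "c * torus_char j l p"] torus_char_mult[symmetric] cnj_torus_char[symmetric]
        by (intro arg_cong2[where f = "(+)"] arg_cong[where f = Re]) (simp_all add: mult_ac)
    qed
    then show ?case by (simp only:) (intro trig_poly.intros)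
  next
    case (add f' g')
    then show ?case by (simp only: distrib_left trig_poly.add)
  qed
next
  case (add f' g')
  then show ?case by (simp only: distrib_right trig_poly.add)
qed

lemma trig_poly_real_polynomial:
  fixes h :: "complex \<times> complex \<Rightarrow> real"
  assumes "real_polynomial_function h"
  shows "trig_poly (\<lambda>p. h (circ (fst p), circ (snd p)))"
  using assms
proof induction
  case (linear h)
  interpret bounded_linear h by fact
  \<comment> \<open>Re ((s - i t) z) = s Re z + t Im z, so these coefficients represent the given
    real linear functional.\<close>
  define a b where "a = of_real (h (1, 0)) - \<i> * of_real (h (\<i>, 0))"
    and "b = of_real (h (0, 1)) - \<i> * of_real (h (0, \<i>))"
  have "h (z, w) = Re (a * z) + Re (b * w)" for z w
  proof -
    have eq: "(z, w) = (Re z *\<^sub>R (1, 0) + Im z *\<^sub>R (\<i>, 0)) + (Re w *\<^sub>R (0, 1) + Im w *\<^sub>R (0, \<i>))"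
      by (simp add: complex_eq_iff)
    show ?thesis
      by (subst eq, unfold add scaleR) (simp add: a_def b_def algebra_simps)
  qed
  moreover have "circ (fst p) = torus_char 1 0 p" "circ (snd p) = torus_char 0 1 p" for p
    by (auto simp: torus_char_def)
  ultimately show ?case
    by (simp only:) (intro trig_poly.intros)
next
  case (const c)
  show ?case using trig_poly.char[of "of_real c" 0 0] by (simp add: torus_char_def)
next
  case (add f g)
  show ?case by (rule trig_poly.add[OF add.IH])
next
  case (mult f g)
  show ?case by (rule trig_poly_mult[OF mult.IH])
qed

section \<open>Continuous functions on the torus and their approximation\<close>

lemma torus_continuous_circle:
  assumes "torus_continuous \<phi>"
  shows "circle_continuous (\<lambda>x. \<phi> (x, y))" "circle_continuous (\<lambda>y. \<phi> (x, y))"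
proof -
  have "continuous_on UNIV (\<lambda>x. \<phi> (x, y))" "continuous_on UNIV (\<lambda>y. \<phi> (x, y))"
    using assms unfolding torus_continuous_def
    by (auto intro!: continuous_on_compose2[of UNIV \<phi>] continuous_on_Pair continuous_on_id continuous_on_const)
  then show "circle_continuous (\<lambda>x. \<phi> (x, y))" "circle_continuous (\<lambda>y. \<phi> (x, y))"
    using assms by (auto simp: torus_continuous_def circle_continuous_def)
qed

lemma torus_continuous_cong:
  assumes \<phi>: "torus_continuous \<phi>" and "fst p - fst q \<in> \<int>" "snd p - snd q \<in> \<int>"
  shows "\<phi> p = \<phi> q"
proof -
  obtain k m :: int where k: "fst p - fst q = of_int k" and m: "snd p - snd q = of_int m"
    using assms by (auto elim!: Ints_cases)
  have "\<phi> p = \<phi> (fst q + of_int k, snd q + of_int m)"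
    unfolding k[symmetric] m[symmetric] by simp
  also have "\<dots> = \<phi> q"
    using circle_continuous_int_shift[OF torus_continuous_circle(1)[OF \<phi>]]
      circle_continuous_int_shift[OF torus_continuous_circle(2)[OF \<phi>]] by simp
  finally show ?thesis .
qed

lemma circ_eq_iff: "circ s = circ t \<longleftrightarrow> s - t \<in> \<int>"
proof
  assume "circ s = circ t"
  then have "circ (s - t) = circ 0"
    using circ_add[of s "-t"] circ_add[of t "-t"] by simp
  then show "s - t \<in> \<int>" by (simp add: circ_eq_1_iff)
qed (rule circ_cong)

text \<open>The torus is embedded in C^2 by the pair of characters \<open>E\<close>, the periodic
  function descends to the compact image \<open>S\<close>, and Stone-Weierstrass gives a polynomial
  there, which pulls back to a trigonometric polynomial.\<close>

lemma trig_poly_dense: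
  assumes \<phi>: "torus_continuous \<phi>" and "0 < e"
  obtains \<psi> where "trig_poly \<psi>" "\<And>p. \<bar>\<phi> p - \<psi> p\<bar> < e"
proof -
  define E where "E = (\<lambda>p. (circ (fst p), circ (snd p)))"
  define Q where "Q = cbox (0::real, 0::real) (1, 1)"
  define S where "S = E ` Q"
  \<comment> \<open>The choice of preimage made by \<open>inv_into\<close> is harmless: points of
    \<open>Q\<close> with the same image differ by integers, where \<phi> agrees.\<close>
  define f where "f = \<phi> \<circ> inv_into Q E"
  have fE: "f (E p) = \<phi> p" if "p \<in> Q" for p
  proof -
    have "E (inv_into Q E (E p)) = E p" using that by (simp add: f_inv_into_f)
    then show ?thesis
      unfolding f_def o_def by (intro torus_continuous_cong[OF \<phi>]) (auto simp: E_def circ_eq_iff)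
  qed
  have cont\<phi>: "continuous_on T \<phi>" for T
    using \<phi> by (auto simp: torus_continuous_def intro: continuous_on_subset)
  have contE: "continuous_on T E" for T
    unfolding E_def by (intro continuous_intros)
  have "compact Q" by (simp add: Q_def)
  then have "compact S" unfolding S_def by (intro compact_continuous_image contE)
  \<comment> \<open>On the compact square \<open>E\<close> is a closed map, hence a quotient map
    onto \<open>S\<close>: the \<open>f\<close>-preimage of a closed set is the
    \<open>E\<close>-image of a compact set.\<close>
  moreover have "continuous_on S f"
    unfolding continuous_on_closed_invariant
  proof (intro allI impI)
    fix B :: "real set" assume "closed B"
    have "closed (Q \<inter> \<phi> -` B)"
      by (intro continuous_closed_preimage cont\<phi> \<open>closed B\<close> compact_imp_closed \<open>compact Q\<close>)
    then have "compact (Q \<inter> (Q \<inter> \<phi> -` B))"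
      by (intro compact_Int_closed \<open>compact Q\<close>)
    then have "closed (E ` (Q \<inter> \<phi> -` B))"
      by (intro compact_imp_closed compact_continuous_image contE) (simp add: Int_assoc[symmetric])
    moreover have "E ` (Q \<inter> \<phi> -` B) \<inter> S = f -` B \<inter> S"
      using fE by (auto simp: S_def)
    ultimately show "\<exists>A. closed A \<and> A \<inter> S = f -` B \<inter> S" by blast
  qed
  ultimately obtain g where g: "real_polynomial_function g" "\<And>x. x \<in> S \<Longrightarrow> \<bar>f x - g x\<bar> < e"
    using Stone_Weierstrass_real_polynomial_function[of S f e] \<open>0 < e\<close> by blast
  show ?thesis
  proof
    show "trig_poly (\<lambda>p. g (E p))"
      unfolding E_def by (rule trig_poly_real_polynomial[OF g(1)])
    show "\<bar>\<phi> p - g (E p)\<bar> < e" for p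
    proof -
      define q where "q = (frac (fst p), frac (snd p))"
      have q: "q \<in> Q" by (auto simp: q_def Q_def frac_ge_0 frac_lt_1 less_imp_le)
      have "\<phi> p = \<phi> q" by (rule torus_continuous_cong[OF \<phi>]) (auto simp: q_def frac_def)
      moreover have "E p = E q" by (auto simp: E_def q_def circ_eq_iff frac_def)
      moreover have "\<bar>f (E q) - g (E q)\<bar> < e" using g q by (auto simp: S_def)
      ultimately show ?thesis using fE[OF q] by simp
    qed
  qed
qed

text \<open>Density packaged as an induction rule: a property of characters that survives sums and
  uniform limits holds for all continuous functions. It serves both the irrational rotation and the
  final convergence statement.\<close>

lemma torus_continuous_induct [consumes 1, case_names char add limit]:
  assumes "torus_continuous \<phi>"
    and char: "\<And>c j l. P (\<lambda>p. Re (c * torus_char j l p))"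
    and add: "\<And>f g. P f \<Longrightarrow> P g \<Longrightarrow> P (\<lambda>p. f p + g p)"
    and limit: "\<And>f. torus_continuous f \<Longrightarrow> (\<And>e. 0 < e \<Longrightarrow> \<exists>g. P g \<and> (\<forall>p. \<bar>f p - g p\<bar> \<le> e)) \<Longrightarrow> P f"
  shows "P \<phi>"
proof (rule limit[OF assms(1)])
  fix e :: real assume "0 < e"
  then obtain g where g: "trig_poly g" "\<And>p. \<bar>\<phi> p - g p\<bar> < e"
    using trig_poly_dense[OF assms(1)] by blast
  from g(1) have "P g"
  proof induction
    case (add f g)
    show ?case by (rule assms(3)[OF add.IH])
  qed (rule char)
  with g(2) show "\<exists>g. P g \<and> (\<forall>p. \<bar>\<phi> p - g p\<bar> \<le> e)" by (auto intro: less_imp_le)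
qed

section \<open>Equidistribution of irrational rotations\<close>

lemma integral_Re_circle:
  assumes "circle_continuous v"
  shows "integral {0..1} (\<lambda>x. Re (v x)) = Re (integral {0..1} v)"
  using integral_linear[OF circle_continuous_integrable[OF assms, of 0 1] bounded_linear_Re]
  by (simp add: o_def)

lemma integral_circle_mono:
  fixes v w :: "real \<Rightarrow> real"
  assumes "circle_continuous v" "circle_continuous w" "\<And>x. v x \<le> w x"
  shows "integral {0..1} v \<le> integral {0..1} w"
  using assms by (intro integral_le circle_continuous_integrable) auto

lemma norm_integral_circle_le:
  assumes "circle_continuous v" "circle_continuous w" "\<And>x. norm (v x) \<le> w x"
  shows "norm (integral {0..1} v) \<le> integral {0..1} w"
  using assms by (intro integral_norm_bound_integral circle_continuous_integrable) auto

text \<open>The orbit sum is a geometric series whose ratio differs from 1 by irrationality, so it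
  is bounded independently of \<open>n\<close> and \<open>x\<close>, and division by
  \<open>n\<close> makes it small.\<close>

lemma weyl_equidistribution_char:
  assumes irr: "\<alpha> \<notin> \<rat>" and "0 < e" and j: "j \<noteq> 0"
  shows "\<exists>N. \<forall>n\<ge>N. \<forall>x. \<bar>(\<Sum>k<n. Re (c * circ (of_int j * (x + of_nat k * \<alpha>)))) / of_nat n\<bar> \<le> e"
proof -
  define q where "q = circ (of_int j * \<alpha>)"
  have "of_int j * \<alpha> \<notin> \<int>"
  proof
    assume "of_int j * \<alpha> \<in> \<int>"
    then obtain m :: int where "of_int j * \<alpha> = of_int m" by (auto elim: Ints_cases)
    then have "\<alpha> = of_int m / of_int j" using j by (simp add: field_simps)
    then show False using irr by simp
  qed
  then have q: "q \<noteq> 1" by (simp add: q_def circ_eq_1_iff)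
  \<comment> \<open>From the closed form (q^n - 1) / (q - 1) of the geometric sum, whose numerator
    has modulus at most 2.\<close>
  define K where "K = norm c * (2 / norm (q - 1))"
  have K: "\<bar>\<Sum>k<n. Re (c * circ (of_int j * (x + of_nat k * \<alpha>)))\<bar> \<le> K" for n x
  proof -
    have circq: "circ (of_int j * (of_nat k * \<alpha>)) = q ^ k" for k
    proof (induction k)
      case (Suc k)
      have "circ (of_int j * (of_nat (Suc k) * \<alpha>)) = circ (of_int j * (of_nat k * \<alpha>) + of_int j * \<alpha>)"
        by (simp add: algebra_simps)
      then show ?case using Suc by (simp add: circ_add q_def)
    qed simp
    have "(\<Sum>k<n. Re (c * circ (of_int j * (x + of_nat k * \<alpha>)))) =
        Re (c * circ (of_int j * x) * (\<Sum>k<n. q ^ k))"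
      unfolding distrib_left circ_add circq by (simp only: Re_sum sum_distrib_left mult.assoc)
    also have "\<bar>\<dots>\<bar> \<le> norm (c * circ (of_int j * x) * (\<Sum>k<n. q ^ k))"
      by (rule abs_Re_le_cmod)
    also have "\<dots> = norm c * norm (\<Sum>k<n. q ^ k)"
      by (simp add: norm_mult)
    also have "(\<Sum>k<n. q ^ k) = (q ^ n - 1) / (q - 1)"
      using q by (rule geometric_sum)
    also have "norm \<dots> = norm (q ^ n - 1) / norm (q - 1)" by (rule norm_divide)
    also have "norm (q ^ n - 1) \<le> 2"
      using norm_triangle_ineq4[of "q ^ n" 1] by (simp add: norm_power q_def)
    then have "norm c * (norm (q ^ n - 1) / norm (q - 1)) \<le> K"
      unfolding K_def by (intro mult_left_mono divide_right_mono) auto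
    finally show ?thesis .
  qed
  obtain N :: nat where N: "K / e < real N" using reals_Archimedean2 by blast
  have "0 \<le> K" by (simp add: K_def)
  show ?thesis
  proof (intro exI allI impI)
    fix n x assume n: "N \<le> n"
    have "K / e < real n" using N n by linarith
    then have pos: "0 < real n" using \<open>0 \<le> K\<close> \<open>0 < e\<close>
      by (smt (verit) divide_nonneg_pos)
    have "\<bar>(\<Sum>k<n. Re (c * circ (of_int j * (x + of_nat k * \<alpha>)))) / of_nat n\<bar> \<le> K / real n"
      unfolding abs_divide abs_of_nat by (intro divide_right_mono K) simp
    also have "\<dots> \<le> e" using \<open>K / e < real n\<close> pos \<open>0 < e\<close> by (simp add: field_simps)
    finally show "\<bar>(\<Sum>k<n. Re (c * circ (of_int j * (x + of_nat k * \<alpha>)))) / of_nat n\<bar> \<le> e" .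
  qed
qed

text \<open>Characters are handled by the preceding lemma, and the rest follows by uniform
  approximation. Uniformity in \<open>x\<close> is needed later, where the average is compared with
  its limit under an integral.\<close>

lemma weyl_equidistribution:
  fixes v :: "real \<Rightarrow> real"
  assumes irr: "\<alpha> \<notin> \<rat>" and v: "circle_continuous v" and "0 < e"
  shows "\<exists>N. \<forall>n\<ge>N. \<forall>x. \<bar>(\<Sum>k<n. v (x + of_nat k * \<alpha>)) / of_nat n - integral {0..1} v\<bar> \<le> e"
proof -
  define A where "A = (\<lambda>w n x. (\<Sum>k<n. w (x + of_nat k * \<alpha>)) / of_nat n :: real)"
  \<comment> \<open>The function \<open>v\<close> is read as a function on the torus that ignores
    the second coordinate, so that the induction rule applies; \<open>P\<close> looks at the slice y
    = 0.\<close>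
  define P where "P = (\<lambda>\<phi>::real \<times> real \<Rightarrow> real. circle_continuous (\<lambda>x. \<phi> (x, 0)) \<and>
     (\<forall>e>0. \<exists>N. \<forall>n\<ge>N. \<forall>x. \<bar>A (\<lambda>x. \<phi> (x, 0)) n x - integral {0..1} (\<lambda>x. \<phi> (x, 0))\<bar> \<le> e))"
  have "torus_continuous (\<lambda>p. v (fst p))"
    using v unfolding torus_continuous_def circle_continuous_def
    by (auto intro!: continuous_on_compose2[of UNIV v] continuous_on_fst continuous_on_id)
  then have "P (\<lambda>p. v (fst p))"
  proof (induction rule: torus_continuous_induct)
    case (char c j l)
    have w: "circle_continuous (\<lambda>x. c * circ (of_int j * x))"
      by (intro circle_continuous_mult circle_continuous_circ circle_continuous_const)
    have eq: "(\<lambda>x. Re (c * torus_char j l (x, 0))) = (\<lambda>x. Re (c * circ (of_int j * x)))"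
      by (simp add: torus_char_def)
    have "\<exists>N. \<forall>n\<ge>N. \<forall>x. \<bar>A (\<lambda>x. Re (c * circ (of_int j * x))) n x
        - integral {0..1} (\<lambda>x. Re (c * circ (of_int j * x)))\<bar> \<le> e" if "0 < e" for e
    proof (cases "j = 0")
      case True
      \<comment> \<open>The function is constant here and its averages are exact from n = 1 on; at n
        = 0 the quotient is 0.\<close>
      then show ?thesis using that by (auto simp: A_def intro!: exI[of _ 1])
    next
      case False
      have "integral {0..1} (\<lambda>x. Re (c * circ (of_int j * x))) = 0"
        unfolding integral_Re_circle[OF w] by (simp add: integral_circ[OF False])
      then show ?thesis
        using weyl_equidistribution_char[OF irr that False, of c] unfolding A_def by (simp only: diff_zero)
    qed
    moreover have "circle_continuous (\<lambda>x. Re (c * circ (of_int j * x)))"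
      by (rule circle_continuous_compose[OF w]) (intro continuous_intros)
    ultimately show ?case unfolding P_def eq by blast
  next
    case (add f g)
    have cf: "circle_continuous (\<lambda>x. f (x, 0))" and cg: "circle_continuous (\<lambda>x. g (x, 0))"
      using add by (auto simp: P_def)
    have "\<exists>N. \<forall>n\<ge>N. \<forall>x. \<bar>A (\<lambda>x. f (x, 0) + g (x, 0)) n x - integral {0..1} (\<lambda>x. f (x, 0) + g (x, 0))\<bar> \<le> e"
      if "0 < e" for e
    proof -
      obtain N1 where N1: "\<And>n x. n \<ge> N1 \<Longrightarrow> \<bar>A (\<lambda>x. f (x, 0)) n x - integral {0..1} (\<lambda>x. f (x, 0))\<bar> \<le> e / 2"
        using add(1) \<open>0 < e\<close> unfolding P_def by (meson half_gt_zero)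
      obtain N2 where N2: "\<And>n x. n \<ge> N2 \<Longrightarrow> \<bar>A (\<lambda>x. g (x, 0)) n x - integral {0..1} (\<lambda>x. g (x, 0))\<bar> \<le> e / 2"
        using add(2) \<open>0 < e\<close> unfolding P_def by (meson half_gt_zero)
      have 1: "integral {0..1} (\<lambda>x. f (x, 0) + g (x, 0)) = integral {0..1} (\<lambda>x. f (x, 0)) + integral {0..1} (\<lambda>x. g (x, 0))"
        by (intro Henstock_Kurzweil_Integration.integral_add circle_continuous_integrable cf cg)
      have 2: "A (\<lambda>x. f (x, 0) + g (x, 0)) n x = A (\<lambda>x. f (x, 0)) n x + A (\<lambda>x. g (x, 0)) n x" for n x
        by (simp add: A_def sum.distrib add_divide_distrib)
      show ?thesis
        unfolding 1 2
      proof (intro exI[of _ "max N1 N2"] allI impI)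
        fix n x assume "max N1 N2 \<le> n"
        then show "\<bar>A (\<lambda>x. f (x, 0)) n x + A (\<lambda>x. g (x, 0)) n x - (integral {0..1} (\<lambda>x. f (x, 0)) + integral {0..1} (\<lambda>x. g (x, 0)))\<bar> \<le> e"
          using N1[of n x] N2[of n x] by linarith
      qed
    qed
    then show ?case using circle_continuous_add[OF cf cg] by (auto simp: P_def)
  next
    case (limit f)
    have cf: "circle_continuous (\<lambda>x. f (x, 0))" by (rule torus_continuous_circle(1)[OF limit(1)])
    have "\<exists>N. \<forall>n\<ge>N. \<forall>x. \<bar>A (\<lambda>x. f (x, 0)) n x - integral {0..1} (\<lambda>x. f (x, 0))\<bar> \<le> e" if "0 < e" for e
    proof -
      obtain g where g: "P g" "\<And>p. \<bar>f p - g p\<bar> \<le> e / 3"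
        using limit(2)[of "e / 3"] \<open>0 < e\<close> by auto
      have cg: "circle_continuous (\<lambda>x. g (x, 0))" using g by (auto simp: P_def)
      obtain N where N: "\<And>n x. n \<ge> N \<Longrightarrow> \<bar>A (\<lambda>x. g (x, 0)) n x - integral {0..1} (\<lambda>x. g (x, 0))\<bar> \<le> e / 3"
        using g(1) \<open>0 < e\<close> unfolding P_def by (meson divide_pos_pos zero_less_numeral)
      have "norm (integral {0..1} (\<lambda>x. f (x, 0) - g (x, 0))) \<le> integral {0..1} (\<lambda>x::real. e / 3)"
        by (intro norm_integral_circle_le circle_continuous_diff circle_continuous_const cf cg) (simp add: g(2) del: le_divide_eq_numeral1)
      then have 1: "\<bar>integral {0..1} (\<lambda>x. f (x, 0)) - integral {0..1} (\<lambda>x. g (x, 0))\<bar> \<le> e / 3"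
        by (simp add: Henstock_Kurzweil_Integration.integral_diff circle_continuous_integrable cf cg)
      have 2: "\<bar>A (\<lambda>x. f (x, 0)) n x - A (\<lambda>x. g (x, 0)) n x\<bar> \<le> e / 3" for n x
      proof (cases "n = 0")
        case False
        have "A (\<lambda>x. f (x, 0)) n x - A (\<lambda>x. g (x, 0)) n x = (\<Sum>k<n. f (x + of_nat k * \<alpha>, 0) - g (x + of_nat k * \<alpha>, 0)) / of_nat n"
          by (simp add: A_def sum_subtractf diff_divide_distrib)
        also have "\<bar>\<dots>\<bar> \<le> (\<Sum>k<n. e / 3) / of_nat n"
          unfolding abs_divide abs_of_nat by (intro divide_right_mono order_trans[OF sum_abs sum_mono]) (use g(2) in auto)
        finally show ?thesis using False by simp
      qed (use \<open>0 < e\<close> in \<open>auto simp: A_def\<close>)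
      show ?thesis
      proof (intro exI[of _ N] allI impI)
        fix n x assume "N \<le> n"
        then show "\<bar>A (\<lambda>x. f (x, 0)) n x - integral {0..1} (\<lambda>x. f (x, 0))\<bar> \<le> e"
          using N[of n x] 1 2[of n x] by linarith
      qed
    qed
    then show ?case using cf by (auto simp: P_def)
  qed
  then show ?thesis using \<open>0 < e\<close> by (auto simp: P_def A_def)
qed

section \<open>Dyadic difference quotients of a Lipschitz lift\<close>

text \<open>Averaging translates does not increase the mean square: the square of an average is at
  most the average of the squares, and each translate has the same integral.\<close>

lemma integral_average_square_le:
  fixes v :: "real \<Rightarrow> real"
  assumes v: "circle_continuous v" and "0 < N"
  shows "integral {0..1} (\<lambda>x. ((\<Sum>i<N. v (x + of_nat i * h)) / of_nat N)\<^sup>2) \<le> integral {0..1} (\<lambda>x. (v x)\<^sup>2)"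
proof -
  have v2: "circle_continuous (\<lambda>x. (v x)\<^sup>2)"
    by (rule circle_continuous_compose[OF v]) (intro continuous_intros)
  have sh: "circle_continuous (\<lambda>x. v (x + t))" "circle_continuous (\<lambda>x. (v (x + t))\<^sup>2)" for t
    using circle_continuous_shift[OF v] circle_continuous_shift[OF v2] .
  have "integral {0..1} (\<lambda>x. ((\<Sum>i<N. v (x + of_nat i * h)) / of_nat N)\<^sup>2)
    \<le> integral {0..1} (\<lambda>x. (\<Sum>i<N. (v (x + of_nat i * h))\<^sup>2) * (1 / of_nat N))"
  proof (rule integral_circle_mono)
    show "circle_continuous (\<lambda>x. ((\<Sum>i<N. v (x + of_nat i * h)) / of_nat N)\<^sup>2)"
      by (rule circle_continuous_compose[of "\<lambda>x. (\<Sum>i<N. v (x + of_nat i * h))" "\<lambda>t. (t / of_nat N)\<^sup>2"])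
         (auto intro!: circle_continuous_sum sh continuous_intros simp: \<open>0 < N\<close>[THEN less_imp_neq, symmetric])
    show "circle_continuous (\<lambda>x. (\<Sum>i<N. (v (x + of_nat i * h))\<^sup>2) * (1 / of_nat N))"
      by (intro circle_continuous_sum circle_continuous_mult sh circle_continuous_const)
    show "((\<Sum>i<N. v (x + of_nat i * h)) / of_nat N)\<^sup>2 \<le> (\<Sum>i<N. (v (x + of_nat i * h))\<^sup>2) * (1 / of_nat N)" for x
      using sum_squared_le_sum_of_squares[of "\<lambda>i. v (x + of_nat i * h)" "{..<N}"] \<open>0 < N\<close>
      by (simp add: power_divide field_simps power2_eq_square)
  qed
  also have "\<dots> = (\<Sum>i<N. integral {0..1} (\<lambda>x. (v (x + of_nat i * h))\<^sup>2)) * (1 / of_nat N)"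
    by (simp add: Henstock_Kurzweil_Integration.integral_sum circle_continuous_integrable sh)
  also have "\<dots> = integral {0..1} (\<lambda>x. (v x)\<^sup>2)"
    using integral_circle_shift[OF v2] \<open>0 < N\<close> by simp
  finally show ?thesis .
qed

text \<open>The analysis concerns only a real-valued lift; the circle map itself returns when the
  iterates of the skew product are identified modulo 1.\<close>

locale lipschitz_lift =
  fixes F :: "real \<Rightarrow> real" and L :: real and d :: int
  assumes lip: "\<And>x y. \<bar>F x - F y\<bar> \<le> L * \<bar>x - y\<bar>"
    and deg: "\<And>x. F (x + 1) = F x + of_int d"
begin

lemma L_nonneg: "0 \<le> L"
  using lip[of 1 0] by simp

lemma continuous_F: "continuous_on S F"
  by (rule continuous_on_subset[of UNIV])
     (use lip L_nonneg in \<open>auto intro!: lipschitz_on_continuous_on[of L] lipschitz_onI simp: dist_real_def\<close>)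

definition diff_quot :: "nat \<Rightarrow> real \<Rightarrow> real" where
  "diff_quot p x = 2 ^ p * (F (x + 1 / 2 ^ p) - F x)"

lemma circle_continuous_lift_minus_linear: "circle_continuous (\<lambda>x. F x - of_int d * x)"
  by (auto simp: circle_continuous_def deg algebra_simps intro!: continuous_intros continuous_F)

text \<open>Splitting off the linear part leaves increments of a periodic function. This yields
  periodicity of the quotient, and its integral \<open>d\<close>, because the periodic part cancels
  under translation.\<close>

lemma diff_quot_eq: "diff_quot p x = 2 ^ p * ((F (x + 1 / 2 ^ p) - of_int d * (x + 1 / 2 ^ p)) - (F x - of_int d * x)) + of_int d"
  by (simp add: diff_quot_def field_simps)

lemma circle_continuous_diff_quot: "circle_continuous (diff_quot p)"
  unfolding diff_quot_eq[abs_def]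
  by (intro circle_continuous_add circle_continuous_mult circle_continuous_diff circle_continuous_const
     circle_continuous_lift_minus_linear
     circle_continuous_shift[where v = "\<lambda>x. F x - of_int d * x"])

lemma integral_diff_quot: "integral {0..1} (diff_quot p) = of_int d"
proof -
  define G where "G = (\<lambda>x. F x - of_int d * x)"
  have G: "circle_continuous G" unfolding G_def by (rule circle_continuous_lift_minus_linear)
  have "integral {0..1} (\<lambda>x. 2 ^ p * (G (x + 1 / 2 ^ p) - G x) + of_int d) =
     2 ^ p * (integral {0..1} (\<lambda>x. G (x + 1 / 2 ^ p)) - integral {0..1} G) + of_int d"
    by (subst Henstock_Kurzweil_Integration.integral_add)
       (simp_all add: circle_continuous_integrable G circle_continuous_shift circle_continuous_mult
          circle_continuous_diff Henstock_Kurzweil_Integration.integral_diff)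
  then show ?thesis
    unfolding diff_quot_eq[abs_def] using integral_circle_shift[OF G] by (simp add: G_def)
qed

lemma diff_quot_bound: "\<bar>diff_quot p x\<bar> \<le> L"
  using lip[of "x + 1 / 2 ^ p" x] by (simp add: diff_quot_def abs_mult pos_le_divide_eq mult.commute)

text \<open>The constant grows with \<open>p\<close>, but it is applied only at one fixed scale
  while the translations become small.\<close>

lemma diff_quot_lipschitz: "\<bar>diff_quot p x - diff_quot p y\<bar> \<le> 2 ^ p * (2 * L) * \<bar>x - y\<bar>"
proof -
  have "\<bar>diff_quot p x - diff_quot p y\<bar> = 2 ^ p * \<bar>(F (x + 1 / 2 ^ p) - F (y + 1 / 2 ^ p)) - (F x - F y)\<bar>"
    by (simp add: diff_quot_def abs_mult flip: right_diff_distrib)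
  also have "\<dots> \<le> 2 ^ p * (L * \<bar>x - y\<bar> + L * \<bar>x - y\<bar>)"
    using lip[of "x + 1 / 2 ^ p" "y + 1 / 2 ^ p"] lip[of x y] by (intro mult_left_mono) auto
  finally show ?thesis by (simp add: algebra_simps)
qed

text \<open>The increments at scale \<open>p\<close> telescope. With dyadic steps a coarse quotient
  is an exact average of translates of a finer one.\<close>

lemma diff_quot_average:
  assumes "k \<le> p"
  shows "diff_quot k x = (\<Sum>i<2 ^ (p - k). diff_quot p (x + of_nat i / 2 ^ p)) / 2 ^ (p - k)"
proof -
  have "(\<Sum>i<N. diff_quot p (x + of_nat i / 2 ^ p)) = 2 ^ p * (F (x + of_nat N / 2 ^ p) - F x)" for N
    by (induction N) (simp_all add: diff_quot_def algebra_simps add_divide_distrib)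
  moreover have "2 ^ p = 2 ^ k * (2::real) ^ (p - k)"
    using assms by (simp flip: power_add)
  ultimately show ?thesis by (simp add: diff_quot_def)
qed

text \<open>Choose \<open>k\<close> with \<open>q k\<close> close to the supremum \<open>Q\<close>,
  then \<open>m\<close> so large that translations by at most 1 / 2^m hardly change the k-th
  quotient. For p \<ge> m the midpoint of the p-th and m-th quotients averages to almost the k-th
  one, so its squared norm is nearly at least \<open>Q\<close>; as both endpoints have squared norm
  at most \<open>Q\<close>, the parallelogram law forces them together.\<close>

lemma diff_quot_Cauchy:
  assumes "0 < e"
  shows "\<exists>m. \<forall>p\<ge>m. integral {0..1} (\<lambda>x. (diff_quot p x - diff_quot m x)\<^sup>2) \<le> e"
proof -
  define q where "q = (\<lambda>p. integral {0..1} (\<lambda>x. (diff_quot p x)\<^sup>2))"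
  have cc2: "circle_continuous (\<lambda>x. (v x)\<^sup>2)" if "circle_continuous v" for v :: "real \<Rightarrow> real"
    by (rule circle_continuous_compose[OF that]) (intro continuous_intros)
  note D2 = cc2[OF circle_continuous_diff_quot]
  have "q p \<le> L\<^sup>2" for p
  proof -
    have "q p \<le> integral {0..1} (\<lambda>x::real. L\<^sup>2)"
      unfolding q_def
      by (intro integral_circle_mono D2 circle_continuous_const)
         (use diff_quot_bound in \<open>auto intro: power2_le_iff_abs_le[THEN iffD2] simp: L_nonneg\<close>)
    then show ?thesis by simp
  qed
  then have bdd: "bdd_above (range q)" by (auto intro!: bdd_aboveI[of _ "L\<^sup>2"])
  define Q where "Q = (SUP p. q p)"
  have qQ: "q p \<le> Q" for p unfolding Q_def by (intro cSUP_upper bdd) simp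
  obtain k where k: "Q - e / 8 < q k"
    using less_cSUP_iff[of UNIV q "Q - e / 8"] bdd assms by (auto simp: Q_def)
  \<comment> \<open>The Lipschitz constant of the k-th quotient times its bound \<open>L\<close>; C
    / 2^m will bound the cross term in the square of \<open>w\<close>.\<close>
  define C where "C = 2 ^ k * (2 * L) * L"
  have "C \<ge> 0" using L_nonneg by (simp add: C_def)
  obtain m0 where m0: "C / (e / 8) < 2 ^ m0"
    using real_arch_pow[of 2 "C / (e / 8)"] by auto
  define m where "m = max k m0"
  have m: "k \<le> m" by (simp add: m_def)
  have "(2::real) ^ m0 \<le> 2 ^ m" by (intro power_increasing) (auto simp: m_def)
  then have "C / (e / 8) \<le> 2 ^ m" using m0 by linarith
  then have Cm: "C / 2 ^ m \<le> e / 8"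
    using assms by (simp add: field_simps)
  show ?thesis
  proof (intro exI[of _ m] allI impI)
    fix p assume p: "m \<le> p"
    define N where "N = (2::nat) ^ (p - k)"
    define M where "M = (2::nat) ^ (p - m)"
    define h where "h = 1 / (2::real) ^ p"
    have pos: "0 < N" "0 < M" by (auto simp: N_def M_def)
    have avk: "diff_quot k x = (\<Sum>i<N. diff_quot p (x + of_nat i * h)) / of_nat N" for x
      using diff_quot_average[of k p x] m p by (simp add: N_def h_def)
    have avm: "diff_quot m x = (\<Sum>i<M. diff_quot p (x + of_nat i * h)) / of_nat M" for x
      using diff_quot_average[of m p x] p by (simp add: M_def h_def)
    define v where "v = (\<lambda>x. (diff_quot p x + diff_quot m x) * (1 / 2))"
    define w where "w = (\<lambda>x. (\<Sum>i<N. v (x + of_nat i * h)) / of_nat N)"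
    have cv: "circle_continuous v" unfolding v_def
      by (intro circle_continuous_mult circle_continuous_add circle_continuous_const circle_continuous_diff_quot)
    have cw: "circle_continuous w" unfolding w_def divide_inverse
      by (intro circle_continuous_sum circle_continuous_shift[OF cv] circle_continuous_mult circle_continuous_const)
    \<comment> \<open>Averaging N translates turns the p-th quotient into the k-th one and the m-th quotient into z,
      which is close to the k-th one; hence the midpoint v has almost maximal norm.\<close>
    define z where "z = (\<lambda>x. (\<Sum>j<M. diff_quot k (x + of_nat j * h)) / of_nat M)"
    have w_eq: "w x = (diff_quot k x + z x) / 2" for x
    proof -
      \<comment> \<open>Write the m-th quotient as an average of p-th ones and exchange the two
        averages.\<close>
      have "(\<Sum>i<N. diff_quot m (x + of_nat i * h)) = (\<Sum>i<N. \<Sum>j<M. diff_quot p (x + of_nat i * h + of_nat j * h) / of_nat M)"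
        unfolding avm by (simp add: sum_divide_distrib)
      also have "\<dots> = (\<Sum>j<M. \<Sum>i<N. diff_quot p (x + of_nat i * h + of_nat j * h) / of_nat M)"
        by (rule sum.swap)
      also have "\<dots> = (\<Sum>j<M. diff_quot k (x + of_nat j * h) * of_nat N / of_nat M)"
        unfolding avk using pos by (simp add: sum_divide_distrib[symmetric] add_ac)
      also have "\<dots> = of_nat N * z x"
        by (simp add: z_def sum_divide_distrib sum_distrib_left mult.commute)
      finally have "(\<Sum>i<N. diff_quot m (x + of_nat i * h)) / of_nat N = z x" using pos by simp
      moreover have "w x = ((\<Sum>i<N. diff_quot p (x + of_nat i * h)) / of_nat N + (\<Sum>i<N. diff_quot m (x + of_nat i * h)) / of_nat N) / 2"
        unfolding w_def v_def by (simp add: sum_divide_distrib[symmetric] sum.distrib add_divide_distrib)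
      ultimately show ?thesis using avk by simp
    qed
    have z: "\<bar>z x - diff_quot k x\<bar> \<le> 2 ^ k * (2 * L) / 2 ^ m" for x
    proof -
      have "z x - diff_quot k x = (\<Sum>j<M. diff_quot k (x + of_nat j * h) - diff_quot k x) / of_nat M"
        using pos by (simp add: z_def sum_subtractf field_simps)
      also have "\<bar>\<dots>\<bar> \<le> (\<Sum>j<M. 2 ^ k * (2 * L) * (1 / 2 ^ m)) / of_nat M"
        unfolding abs_divide abs_of_nat
      proof (intro divide_right_mono order_trans[OF sum_abs sum_mono])
        fix j assume "j \<in> {..<M}"
        have "real M * h = 1 / 2 ^ m"
          using p power_add[of "2::real" "p - m" m] by (simp add: M_def h_def field_simps)
        moreover have "real j * h \<le> real M * h"
          using \<open>j \<in> {..<M}\<close> by (intro mult_right_mono) (auto simp: h_def)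
        moreover have "0 \<le> real j * h" by (simp add: h_def)
        ultimately have "\<bar>x + real j * h - x\<bar> \<le> 1 / 2 ^ m" by simp
        then have "2 ^ k * (2 * L) * \<bar>x + real j * h - x\<bar> \<le> 2 ^ k * (2 * L) * (1 / 2 ^ m)"
          using L_nonneg by (intro mult_left_mono) auto
        then show "\<bar>diff_quot k (x + of_nat j * h) - diff_quot k x\<bar> \<le> 2 ^ k * (2 * L) * (1 / 2 ^ m)"
          using diff_quot_lipschitz[of k "x + of_nat j * h" x] by linarith
      qed simp
      also have "\<dots> = 2 ^ k * (2 * L) / 2 ^ m" using pos by simp
      finally show ?thesis .
    qed
    have "(diff_quot k x)\<^sup>2 - e / 8 \<le> (w x)\<^sup>2" for x
    proof -
      have "(w x)\<^sup>2 = (diff_quot k x)\<^sup>2 + diff_quot k x * (z x - diff_quot k x) + ((z x - diff_quot k x) / 2)\<^sup>2"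
        unfolding w_eq by (simp add: power2_eq_square field_simps)
      moreover have "\<bar>diff_quot k x * (z x - diff_quot k x)\<bar> \<le> L * (2 ^ k * (2 * L) / 2 ^ m)"
        unfolding abs_mult by (intro mult_mono diff_quot_bound z L_nonneg) simp
      moreover have "L * (2 ^ k * (2 * L) / 2 ^ m) = C / 2 ^ m" by (simp add: C_def)
      moreover have "0 \<le> ((z x - diff_quot k x) / 2)\<^sup>2" by simp
      ultimately show ?thesis using Cm by linarith
    qed
    then have "integral {0..1} (\<lambda>x. (diff_quot k x)\<^sup>2 - e / 8) \<le> integral {0..1} (\<lambda>x. (w x)\<^sup>2)"
      by (intro integral_circle_mono circle_continuous_diff D2 circle_continuous_const cc2[OF cw])
    also have "\<dots> \<le> integral {0..1} (\<lambda>x. (v x)\<^sup>2)"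
      unfolding w_def by (rule integral_average_square_le[OF cv \<open>0 < N\<close>])
    also have "integral {0..1} (\<lambda>x. (diff_quot k x)\<^sup>2 - e / 8) = q k - e / 8"
      unfolding q_def
      by (subst Henstock_Kurzweil_Integration.integral_diff) (auto intro: circle_continuous_integrable D2)
    finally have v: "Q - e / 4 \<le> integral {0..1} (\<lambda>x. (v x)\<^sup>2)" using k by linarith
    \<comment> \<open>Parallelogram law with midpoint \<open>v\<close>; after integration the bound
      is 4 Q - 4 (Q - e / 4) = e.\<close>
    have "(diff_quot p x - diff_quot m x)\<^sup>2 = 2 * (diff_quot p x)\<^sup>2 + 2 * (diff_quot m x)\<^sup>2 - 4 * (v x)\<^sup>2" for x
      by (simp add: v_def power2_eq_square field_simps)
    then have "integral {0..1} (\<lambda>x. (diff_quot p x - diff_quot m x)\<^sup>2) =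
      integral {0..1} (\<lambda>x. 2 * (diff_quot p x)\<^sup>2 + 2 * (diff_quot m x)\<^sup>2 - 4 * (v x)\<^sup>2)" by simp
    also have "\<dots> = 2 * q p + 2 * q m - 4 * integral {0..1} (\<lambda>x. (v x)\<^sup>2)"
      unfolding q_def
      by (simp add: Henstock_Kurzweil_Integration.integral_diff Henstock_Kurzweil_Integration.integral_add
          circle_continuous_integrable circle_continuous_add circle_continuous_mult D2 cc2[OF cv])
    also have "\<dots> \<le> e" using v qQ[of p] qQ[of m] by linarith
    finally show "integral {0..1} (\<lambda>x. (diff_quot p x - diff_quot m x)\<^sup>2) \<le> e" .
  qed
qed

text \<open>Mean-square closeness e^2 gives mean closeness e, through t \<le> t^2 / (2 e) + e /
  2.\<close>

lemma diff_quot_Cauchy_L1: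
  assumes "0 < e"
  shows "\<exists>m. \<forall>p\<ge>m. integral {0..1} (\<lambda>x. \<bar>diff_quot p x - diff_quot m x\<bar>) \<le> e"
proof -
  obtain m where m: "\<And>p. p \<ge> m \<Longrightarrow> integral {0..1} (\<lambda>x. (diff_quot p x - diff_quot m x)\<^sup>2) \<le> e\<^sup>2"
    using diff_quot_Cauchy[of "e\<^sup>2"] assms by auto
  have "integral {0..1} (\<lambda>x. \<bar>diff_quot p x - diff_quot m x\<bar>) \<le> e" if "p \<ge> m" for p
  proof -
    have cd: "circle_continuous (\<lambda>x. diff_quot p x - diff_quot m x)"
      by (intro circle_continuous_diff circle_continuous_diff_quot)
    have cd2: "circle_continuous (\<lambda>x. (diff_quot p x - diff_quot m x)\<^sup>2)"
      by (rule circle_continuous_compose[OF cd]) (intro continuous_intros)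
    have "integral {0..1} (\<lambda>x. \<bar>diff_quot p x - diff_quot m x\<bar>) \<le> integral {0..1} (\<lambda>x. (1 / (2 * e)) * (diff_quot p x - diff_quot m x)\<^sup>2 + e / 2)"
    proof (rule integral_circle_mono)
      show "circle_continuous (\<lambda>x. \<bar>diff_quot p x - diff_quot m x\<bar>)" using circle_continuous_norm[OF cd] by simp
      show "circle_continuous (\<lambda>x. (1 / (2 * e)) * (diff_quot p x - diff_quot m x)\<^sup>2 + e / 2)"
        by (intro circle_continuous_add circle_continuous_mult cd2 circle_continuous_const)
      show "\<bar>diff_quot p x - diff_quot m x\<bar> \<le> (1 / (2 * e)) * (diff_quot p x - diff_quot m x)\<^sup>2 + e / 2" for x
        using zero_le_power2[of "\<bar>diff_quot p x - diff_quot m x\<bar> - e"] assms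
        by (simp add: power2_diff field_simps power2_eq_square)
    qed
    also have "\<dots> = (1 / (2 * e)) * integral {0..1} (\<lambda>x. (diff_quot p x - diff_quot m x)\<^sup>2) + e / 2"
      by (subst Henstock_Kurzweil_Integration.integral_add) (auto intro!: circle_continuous_integrable circle_continuous_mult cd2 simp del: times_divide_eq_left)
    also have "\<dots> \<le> (1 / (2 * e)) * e\<^sup>2 + e / 2"
      using m[OF that] assms by (intro add_right_mono mult_left_mono) auto
    also have "\<dots> = e" using assms by (simp add: power2_eq_square)
    finally show ?thesis .
  qed
  then show ?thesis by blast
qed

section \<open>Birkhoff sums of the lift and decay of their exponential integrals\<close>

definition birkhoff :: "real \<Rightarrow> nat \<Rightarrow> real \<Rightarrow> real" where
  "birkhoff \<alpha> n x = (\<Sum>k<n. F (x + of_nat k * \<alpha>))"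

lemma continuous_birkhoff: "continuous_on A (birkhoff \<alpha> n)"
  unfolding birkhoff_def
  by (intro continuous_intros continuous_on_compose2[OF continuous_F[of UNIV]]) auto

lemma birkhoff_period: "birkhoff \<alpha> n (x + 1) = birkhoff \<alpha> n x + of_int (int n * d)"
proof -
  have "F (x + 1 + of_nat k * \<alpha>) = F (x + of_nat k * \<alpha>) + of_int d" for k
    using deg[of "x + of_nat k * \<alpha>"] by (simp add: algebra_simps)
  then show ?thesis by (simp add: birkhoff_def sum.distrib)
qed

lemma circle_continuous_circ_birkhoff: "circle_continuous (\<lambda>x. circ (of_int l * birkhoff \<alpha> n x))"
proof -
  have "circ (of_int l * birkhoff \<alpha> n (x + 1)) = circ (of_int l * birkhoff \<alpha> n x)" for x
    by (rule circ_cong) (simp add: birkhoff_period distrib_left)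
  then show ?thesis
    by (auto simp: circle_continuous_def intro!: continuous_intros continuous_birkhoff)
qed

text \<open>The cocycle identity. Together with translation invariance it makes the correlations of
  the exponentials depend only on the difference of the indices.\<close>

lemma birkhoff_diff: "birkhoff \<alpha> (n + m) x - birkhoff \<alpha> n x = birkhoff \<alpha> m (x + of_nat n * \<alpha>)"
  unfolding birkhoff_def by (induction m) (simp_all add: algebra_simps)

text \<open>Discrete integration by parts. With u = e(lS), the increment u (x + h) - u x has
  integral 0, while its linear part is 2 \<pi> i l h B u, because the increment of S is h B. The
  Taylor error is of order h^2, so division by 2 \<pi> h leaves a bound of order h. The factor |l|
  is kept to avoid dividing by \<open>l\<close>.\<close>

lemma integral_diff_quot_circ_birkhoff:
  "norm (integral {0..1} (\<lambda>x. of_real (\<Sum>k<n. diff_quot p (x + of_nat k * \<alpha>)) * circ (of_int l * birkhoff \<alpha> n x)))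
     * \<bar>of_int l\<bar> \<le> pi * (of_int l)\<^sup>2 * (of_nat n * L)\<^sup>2 / 2 ^ p"
proof -
  define u where "u = (\<lambda>x. circ (of_int l * birkhoff \<alpha> n x))"
  define B where "B = (\<lambda>x. \<Sum>k<n. diff_quot p (x + of_nat k * \<alpha>))"
  define h where "h = 1 / (2::real) ^ p"
  have h: "0 < h" by (simp add: h_def)
  have cu: "circle_continuous u" unfolding u_def by (rule circle_continuous_circ_birkhoff)
  have cB: "circle_continuous B" unfolding B_def
    by (intro circle_continuous_sum circle_continuous_shift[OF circle_continuous_diff_quot])
  have cB': "circle_continuous (\<lambda>x. complex_of_real (B x))"
    by (rule circle_continuous_compose[OF cB]) (intro continuous_intros)
  \<comment> \<open>\<open>r\<close> is the exact increment and \<open>s\<close> its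
    linearization.\<close>
  define r where "r = (\<lambda>x. u (x + h) - u x)"
  define s where "s = (\<lambda>x. (2 * pi * \<i> * of_int l * h) * (of_real (B x) * u x))"
  have cr: "circle_continuous r" unfolding r_def
    by (intro circle_continuous_diff circle_continuous_shift[OF cu] cu)
  have cs: "circle_continuous s" unfolding s_def
    by (intro circle_continuous_mult circle_continuous_const cu cB')
  have int_r: "integral {0..1} r = 0"
    unfolding r_def
    by (subst Henstock_Kurzweil_Integration.integral_diff)
       (auto intro: circle_continuous_integrable circle_continuous_shift[OF cu] cu simp: integral_circle_shift[OF cu])
  have g: "birkhoff \<alpha> n (x + h) - birkhoff \<alpha> n x = h * B x" for x
    unfolding birkhoff_def B_def by (simp add: diff_quot_def h_def sum_distrib_left sum_subtractf[symmetric] algebra_simps)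
  have B_bound: "\<bar>B x\<bar> \<le> of_nat n * L" for x
    using sum_norm_le[of "{..<n}" "\<lambda>k. diff_quot p (x + of_nat k * \<alpha>)" "\<lambda>_. L"] diff_quot_bound by (simp add: B_def)
  have rs: "norm (r x - s x) \<le> 2 * pi\<^sup>2 * (of_int l * h)\<^sup>2 * (of_nat n * L)\<^sup>2" for x
  proof -
    have "of_int l * birkhoff \<alpha> n (x + h) = of_int l * (h * B x) + of_int l * birkhoff \<alpha> n x"
      using g[of x] by (simp add: algebra_simps)
    then have "r x - s x = (circ (of_int l * (h * B x)) - 1 - 2 * pi * \<i> * of_real (of_int l * (h * B x))) * u x"
      by (simp add: r_def s_def u_def circ_add algebra_simps)
    then have "norm (r x - s x) \<le> 2 * pi\<^sup>2 * (of_int l * (h * B x))\<^sup>2"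
      using circ_taylor[of "of_int l * (h * B x)"] by (simp add: norm_mult u_def)
    also have "\<dots> = 2 * pi\<^sup>2 * (of_int l * h)\<^sup>2 * \<bar>B x\<bar>\<^sup>2" by (simp add: power_mult_distrib)
    also have "\<dots> \<le> 2 * pi\<^sup>2 * (of_int l * h)\<^sup>2 * (of_nat n * L)\<^sup>2"
      by (intro mult_left_mono power_mono B_bound) auto
    finally show ?thesis .
  qed
  have "norm (integral {0..1} (\<lambda>x. r x - s x)) \<le> integral {0..1} (\<lambda>x::real. 2 * pi\<^sup>2 * (of_int l * h)\<^sup>2 * (of_nat n * L)\<^sup>2)"
    by (intro norm_integral_circle_le circle_continuous_diff cr cs circle_continuous_const rs)
  moreover have "integral {0..1} (\<lambda>x. r x - s x) = - integral {0..1} s"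
    by (subst Henstock_Kurzweil_Integration.integral_diff) (auto intro: circle_continuous_integrable cr cs simp: int_r)
  ultimately have "norm (integral {0..1} s) \<le> 2 * pi\<^sup>2 * (of_int l * h)\<^sup>2 * (of_nat n * L)\<^sup>2"
    by simp
  moreover have "integral {0..1} s = (2 * pi * \<i> * of_int l * h) * integral {0..1} (\<lambda>x. of_real (B x) * u x)"
    unfolding s_def by simp
  ultimately have "(2 * pi * h) * (norm (integral {0..1} (\<lambda>x. of_real (B x) * u x)) * \<bar>of_int l\<bar>)
     \<le> (2 * pi * h) * (pi * (of_int l)\<^sup>2 * (of_nat n * L)\<^sup>2 * h)"
    using h by (simp add: norm_mult power2_eq_square mult_ac)
  then have "norm (integral {0..1} (\<lambda>x. of_real (B x) * u x)) * \<bar>of_int l\<bar> \<le> pi * (of_int l)\<^sup>2 * (of_nat n * L)\<^sup>2 * h"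
    using h by (subst (asm) mult_le_cancel_left_pos) auto
  then show ?thesis by (simp add: B_def u_def h_def)
qed

text \<open>Compare d times the integral of u with the integral of A u, where A is the orbit average
  of a fine difference quotient. The latter is small by integration by parts, and A is close to d in
  mean by the Cauchy property and equidistribution. The scale \<open>m\<close> is chosen first, then
  \<open>N\<close> for that scale, and only then, for each \<open>n\<close>, the fine scale
  \<open>p\<close>.\<close>

theorem integral_circ_birkhoff_tendsto_0:
  assumes irr: "\<alpha> \<notin> \<rat>" and "d \<noteq> 0" "l \<noteq> 0"
  shows "(\<lambda>n. integral {0..1} (\<lambda>x. circ (of_int l * birkhoff \<alpha> n x))) \<longlonglongrightarrow> 0"
proof (rule LIMSEQ_I)
  fix e :: real assume "0 < e"
  \<comment> \<open>Three errors of size \<open>e'\<close> occur below, so their sum stays strictly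
    under \<open>e\<close>.\<close>
  define e' where "e' = e / 4"
  have e': "0 < e'" using \<open>0 < e\<close> by (simp add: e'_def)
  obtain m where m: "\<And>p. p \<ge> m \<Longrightarrow> integral {0..1} (\<lambda>x. \<bar>diff_quot p x - diff_quot m x\<bar>) \<le> e'"
    using diff_quot_Cauchy_L1[OF e'] by blast
  obtain N where N: "\<And>n x. n \<ge> N \<Longrightarrow> \<bar>(\<Sum>k<n. diff_quot m (x + of_nat k * \<alpha>)) / of_nat n - of_int d\<bar> \<le> e'"
    using weyl_equidistribution[OF irr circle_continuous_diff_quot e', of m] unfolding integral_diff_quot by blast
  have "norm (integral {0..1} (\<lambda>x. circ (of_int l * birkhoff \<alpha> n x))) < e" if n: "n \<ge> max N 1" for n
  proof -
    define u where "u = (\<lambda>x. circ (of_int l * birkhoff \<alpha> n x))"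
    have cu: "circle_continuous u" unfolding u_def by (rule circle_continuous_circ_birkhoff)
    have n0: "0 < real n" using n by auto
    \<comment> \<open>The numerator in the integration by parts bound. It grows with
      \<open>n\<close>, but \<open>p\<close> may depend on \<open>n\<close> because the estimate at
      scale \<open>m\<close> holds for every p \<ge> m.\<close>
    define K where "K = pi * (of_int l)\<^sup>2 * (of_nat n * L)\<^sup>2"
    obtain p0 where p0: "K / e' < 2 ^ p0"
      using real_arch_pow[of 2 "K / e'"] by auto
    define p where "p = max m p0"
    have "(2::real) ^ p0 \<le> 2 ^ p" by (intro power_increasing) (auto simp: p_def)
    then have "K / e' \<le> 2 ^ p" using p0 by linarith
    then have Kp: "K / 2 ^ p \<le> e'" using e' by (simp add: field_simps)
    have pm: "p \<ge> m" by (simp add: p_def)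
    define A where "A = (\<lambda>p x. (\<Sum>k<n. diff_quot p (x + of_nat k * \<alpha>)) * (1 / of_nat n))"
    have cA: "circle_continuous (A p)" for p unfolding A_def
      by (intro circle_continuous_mult circle_continuous_const circle_continuous_sum circle_continuous_shift[OF circle_continuous_diff_quot])
    have cAu: "circle_continuous (\<lambda>x. of_real (A p x) * u x)" for p
      by (rule circle_continuous_mult[OF circle_continuous_compose[OF cA] cu]) (intro continuous_intros)
    have cD: "circle_continuous (\<lambda>x. \<bar>diff_quot p x - diff_quot m x\<bar>)"
      using circle_continuous_norm[OF circle_continuous_diff[OF circle_continuous_diff_quot circle_continuous_diff_quot]] by simp
    have 1: "norm (integral {0..1} (\<lambda>x. of_real (A p x) * u x)) \<le> e'"
    proof -
      have "integral {0..1} (\<lambda>x. of_real (A p x) * u x) =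
          integral {0..1} (\<lambda>x. of_real (\<Sum>k<n. diff_quot p (x + of_nat k * \<alpha>)) * u x * (1 / of_nat n))"
        by (simp add: A_def)
      also have "\<dots> = integral {0..1} (\<lambda>x. of_real (\<Sum>k<n. diff_quot p (x + of_nat k * \<alpha>)) * u x) * (1 / of_nat n)"
        by (rule integral_mult_left)
      finally have "norm (integral {0..1} (\<lambda>x. of_real (A p x) * u x)) =
          norm (integral {0..1} (\<lambda>x. of_real (\<Sum>k<n. diff_quot p (x + of_nat k * \<alpha>)) * u x)) / real n"
        by (simp add: norm_divide)
      \<comment> \<open>Discard 1 / n \<le> 1, then insert |l| \<ge> 1 to meet the form of the
        bound.\<close>
      also have "\<dots> \<le> norm (integral {0..1} (\<lambda>x. of_real (\<Sum>k<n. diff_quot p (x + of_nat k * \<alpha>)) * u x)) * 1"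
        unfolding divide_inverse using n by (intro mult_left_mono) (auto simp: field_simps)
      also have "\<dots> \<le> norm (integral {0..1} (\<lambda>x. of_real (\<Sum>k<n. diff_quot p (x + of_nat k * \<alpha>)) * u x)) * \<bar>of_int l\<bar>"
        using \<open>l \<noteq> 0\<close> by (intro mult_left_mono) auto
      also have "\<dots> \<le> K / 2 ^ p"
        using integral_diff_quot_circ_birkhoff unfolding u_def K_def .
      finally show ?thesis using Kp by simp
    qed
    \<comment> \<open>Split A p - d at A m: the first difference is small in mean, as an average of
      translates, and the second is uniformly small.\<close>
    have 2: "norm (integral {0..1} (\<lambda>x. of_real (A p x) * u x - of_int d * u x)) \<le> 2 * e'"
    proof -
      have "norm (of_real (A p x) * u x - of_int d * u x)
          \<le> (\<Sum>k<n. \<bar>diff_quot p (x + of_nat k * \<alpha>) - diff_quot m (x + of_nat k * \<alpha>)\<bar>) * (1 / of_nat n) + e'" for x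
      proof -
        have "of_real (A p x) * u x - of_int d * u x = of_real (A p x - of_int d) * u x"
          by (simp add: algebra_simps)
        then have "norm (of_real (A p x) * u x - of_int d * u x) = \<bar>A p x - of_int d\<bar>"
          by (simp only: norm_mult norm_of_real) (simp add: u_def)
        moreover have "\<bar>A m x - of_int d\<bar> \<le> e'" using N[of n x] n by (simp add: A_def)
        moreover have "A p x - A m x = (\<Sum>k<n. diff_quot p (x + of_nat k * \<alpha>) - diff_quot m (x + of_nat k * \<alpha>)) * (1 / of_nat n)"
          by (simp add: A_def sum_subtractf left_diff_distrib diff_divide_distrib)
        moreover have "\<bar>\<dots>\<bar> \<le> (\<Sum>k<n. \<bar>diff_quot p (x + of_nat k * \<alpha>) - diff_quot m (x + of_nat k * \<alpha>)\<bar>) * (1 / of_nat n)"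
          unfolding abs_mult using n0 by (intro mult_mono sum_abs) (auto intro: sum_nonneg)
        ultimately show ?thesis by linarith
      qed
      then have "norm (integral {0..1} (\<lambda>x. of_real (A p x) * u x - of_int d * u x))
        \<le> integral {0..1} (\<lambda>x. (\<Sum>k<n. \<bar>diff_quot p (x + of_nat k * \<alpha>) - diff_quot m (x + of_nat k * \<alpha>)\<bar>) * (1 / of_nat n) + e')"
        by (intro norm_integral_circle_le circle_continuous_diff cAu circle_continuous_add circle_continuous_mult
          circle_continuous_const cu circle_continuous_sum circle_continuous_shift[OF cD])
      also have "\<dots> = (\<Sum>k<n. integral {0..1} (\<lambda>x. \<bar>diff_quot p (x + of_nat k * \<alpha>) - diff_quot m (x + of_nat k * \<alpha>)\<bar>)) * (1 / of_nat n) + e'"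
        by (simp add: Henstock_Kurzweil_Integration.integral_add Henstock_Kurzweil_Integration.integral_sum
           circle_continuous_integrable circle_continuous_mult circle_continuous_sum circle_continuous_shift[OF cD] del: mult_1_right times_divide_eq_right)
      also have "\<dots> = integral {0..1} (\<lambda>x. \<bar>diff_quot p x - diff_quot m x\<bar>) + e'"
        using n0 integral_circle_shift[OF cD] by simp
      also have "\<dots> \<le> 2 * e'" using m[OF pm] by simp
      finally show ?thesis .
    qed
    have "integral {0..1} (\<lambda>x. of_real (A p x) * u x - of_int d * u x) =
       integral {0..1} (\<lambda>x. of_real (A p x) * u x) - of_int d * integral {0..1} u"
      by (subst Henstock_Kurzweil_Integration.integral_diff)
         (auto intro!: circle_continuous_integrable cAu circle_continuous_mult cu)
    then have "norm (of_int d * integral {0..1} u) \<le> 3 * e'"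
      using 1 2 norm_triangle_ineq4[of "integral {0..1} (\<lambda>x. of_real (A p x) * u x)"
        "integral {0..1} (\<lambda>x. of_real (A p x) * u x - of_int d * u x)"] by simp
    moreover have "norm (integral {0..1} u) * 1 \<le> norm (integral {0..1} u) * \<bar>of_int d\<bar>"
      using \<open>d \<noteq> 0\<close> by (intro mult_left_mono) auto
    ultimately show ?thesis using e' by (simp add: norm_mult u_def mult.commute e'_def)
  qed
  then show "\<exists>no. \<forall>n\<ge>no. norm (integral {0..1} (\<lambda>x. circ (of_int l * birkhoff \<alpha> n x)) - 0) < e" by (intro exI[of _ "max N 1"]) simp
qed

end

section \<open>Decay of correlations implies weak convergence\<close>

text \<open>The marginal hypothesis enters the argument through this conversion: integrals of
  functions of the first coordinate become integrals over the circle, the endpoint 1 being a null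
  set.\<close>

lemma integral_fst_marginal:
  fixes v :: "real \<Rightarrow> 'a::euclidean_space"
  assumes borel: "sets \<mu> = sets (borel :: (real \<times> real) measure)"
    and proj: "distr \<mu> lborel fst = density lborel (indicator {0..<1})"
    and v: "continuous_on UNIV v"
  shows "(\<integral>p. v (fst p) \<partial>\<mu>) = integral {0..1} v"
proof -
  have vm: "v \<in> borel_measurable borel" by (rule borel_measurable_continuous_onI[OF v])
  have "fst \<in> measurable \<mu> lborel"
    using borel by (simp add: measurable_cong_sets[OF borel] borel_measurable_continuous_onI continuous_on_fst)
  then have "(\<integral>p. v (fst p) \<partial>\<mu>) = (\<integral>x. v x \<partial>distr \<mu> lborel fst)"
    by (rule integral_distr[symmetric]) (use vm in simp)
  also have "\<dots> = (\<integral>x. v x \<partial>density lborel (\<lambda>x. ennreal (indicator {0..<1} x)))"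
    by (simp only: proj ennreal_indicator)
  also have "\<dots> = set_lebesgue_integral lborel {0..<1} v"
    unfolding set_lebesgue_integral_def by (rule integral_density) (use vm in auto)
  also have "\<dots> = integral {0..<1} v"
  proof (rule set_borel_integral_eq_integral)
    have "set_integrable lborel {0..1} v"
      by (rule borel_integrable_atLeastAtMost') (rule continuous_on_subset[OF v], simp)
    then show "set_integrable lborel {0..<1} v"
      by (rule set_integrable_subset) auto
  qed
  also have "\<dots> = integral {0..1} v"
    by (rule integral_spike_set; rule negligible_subset[of "{1::real}"]) auto
  finally show ?thesis .
qed

lemma integrable_bounded_continuous:
  fixes w :: "'a::topological_space \<Rightarrow> 'b::euclidean_space"
  assumes prob: "prob_space \<mu>" and borel: "sets \<mu> = sets borel"
    and w: "continuous_on UNIV w" "\<And>p. norm (w p) \<le> C"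
  shows "integrable \<mu> w"
proof -
  interpret prob_space \<mu> by fact
  have "w \<in> borel_measurable \<mu>"
    unfolding measurable_cong_sets[OF borel refl] by (rule borel_measurable_continuous_onI) fact
  then show ?thesis
    using w(2) by (intro integrable_const_bound[of _ C]) auto
qed

lemma strict_mono_add_le:
  assumes "strict_mono (r :: nat \<Rightarrow> nat)"
  shows "r i + k \<le> r (i + k)"
proof (induction k)
  case (Suc k)
  have "r (i + k) < r (Suc (i + k))" using assms by (simp add: strict_mono_Suc_iff)
  with Suc show ?case by simp
qed simp

text \<open>If the integrals stayed above \<open>e\<close> infinitely often, take K such indices
  with large gaps and add the corresponding \<open>u\<close> with phases that align the integrals.
  The sum \<open>V\<close> then has mean modulus at least K e. This mean depends on the marginal
  alone, and nearly orthogonal terms give a squared norm of at most K + K^2 e^2 / 4, which is too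
  small for large K.\<close>

lemma mixing_imp_weak_null:
  fixes u :: "nat \<Rightarrow> real \<Rightarrow> complex" and G :: "real \<times> real \<Rightarrow> complex"
  assumes prob: "prob_space \<mu>"
    and borel: "sets \<mu> = sets borel"
    and proj: "distr \<mu> lborel fst = density lborel (indicator {0..<1})"
    and cu: "\<And>n. circle_continuous (u n)" and nu: "\<And>n x. norm (u n x) = 1"
    and corr: "\<And>n m. integral {0..1} (\<lambda>x. u (n + m) x * cnj (u n x)) = c m"
    and c: "c \<longlonglongrightarrow> 0"
    and G: "continuous_on UNIV G" "\<And>p. norm (G p) \<le> 1"
  shows "(\<lambda>n. \<integral>p. G p * u n (fst p) \<partial>\<mu>) \<longlonglongrightarrow> 0"
proof (rule ccontr)
  interpret prob_space \<mu> by fact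
  define a where "a = (\<lambda>n. \<integral>p. G p * u n (fst p) \<partial>\<mu>)"
  assume "\<not> (\<lambda>n. \<integral>p. G p * u n (fst p) \<partial>\<mu>) \<longlonglongrightarrow> 0"
  then obtain e where e: "0 < e" "\<And>N. \<exists>n\<ge>N. e \<le> norm (a n)"
    unfolding a_def[symmetric] LIMSEQ_iff by (auto simp: not_less)
  define B where "B = {n. e \<le> norm (a n)}"
  have "infinite B"
    using e(2) unfolding infinite_nat_iff_unbounded_le B_def by blast
  define r where "r = enumerate B"
  have r: "strict_mono r" "\<And>i. r i \<in> B"
    using \<open>infinite B\<close> by (auto simp: r_def strict_mono_enumerate enumerate_in_set)
  obtain g0 where g0: "\<And>m. m \<ge> g0 \<Longrightarrow> norm (c m) < e\<^sup>2 / 4"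
    using LIMSEQ_D[OF c, of "e\<^sup>2 / 4"] e(1) by auto
  obtain K :: nat where K: "2 / e\<^sup>2 < real K" using reals_Archimedean2 by blast
  have "0 < 2 / e\<^sup>2" using e(1) by simp
  then have K0: "0 < real K" using K by linarith
  \<comment> \<open>Every (g0 + 1)-th element of the bad set; strict monotonicity turns this into
    gaps of at least \<open>g0\<close>, and the successor keeps the indices distinct when g0 =
    0.\<close>
  define n where "n = (\<lambda>i. r (i * Suc g0))"
  have gap: "\<exists>m\<ge>g0. n j = n i + m" if "i < j" for i j
  proof -
    obtain k where k: "j = i + Suc k" using less_imp_Suc_add[OF \<open>i < j\<close>] by auto
    have "n i + Suc k * Suc g0 \<le> n j"
      using strict_mono_add_le[OF r(1), of "i * Suc g0" "Suc k * Suc g0"]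
      unfolding n_def k add_mult_distrib by simp
    moreover have "g0 \<le> Suc k * Suc g0" by simp
    ultimately show ?thesis by (intro exI[of _ "n j - n i"]) linarith
  qed
  \<comment> \<open>The phase that rotates \<open>a (n i)\<close> onto the nonnegative real
    axis.\<close>
  define s where "s = (\<lambda>i. cnj (sgn (a (n i))))"
  have s: "s i * a (n i) = of_real (norm (a (n i)))" "norm (s i) \<le> 1" for i
  proof -
    show "s i * a (n i) = of_real (norm (a (n i)))"
      by (cases "a (n i) = 0")
         (simp_all add: s_def sgn_eq complex_norm_square[symmetric] power2_eq_square mult.commute[of "cnj _"] field_simps)
    show "norm (s i) \<le> 1" by (simp add: s_def norm_sgn)
  qed
  define V where "V = (\<lambda>x. \<Sum>i<K. s i * u (n i) x)"
  have cV: "circle_continuous V" unfolding V_def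
    by (intro circle_continuous_sum circle_continuous_mult circle_continuous_const cu)
  have cV2: "circle_continuous (\<lambda>x. (norm (V x))\<^sup>2)"
    by (rule circle_continuous_compose[OF circle_continuous_norm[OF cV]]) (intro continuous_intros)
  have cont_fst: "continuous_on UNIV (\<lambda>p::real \<times> real. v (fst p))" if "circle_continuous v" for v :: "real \<Rightarrow> 'b::euclidean_space"
    by (rule continuous_on_compose2[OF circle_continuousD(1)[OF that, of UNIV]]) (auto intro: continuous_intros)
  note integrableI = integrable_bounded_continuous[OF prob borel]
  have intGu: "integrable \<mu> (\<lambda>p. G p * u m (fst p))" for m
    by (rule integrableI[of _ 1]) (auto intro!: continuous_on_mult G cont_fst cu simp: norm_mult nu)
  have nV: "norm (V x) \<le> real K" for x
  proof -
    have "norm (V x) \<le> (\<Sum>i<K. 1)"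
      unfolding V_def by (rule sum_norm_le) (use s(2) in \<open>auto simp: norm_mult nu\<close>)
    then show ?thesis by simp
  qed
  define M where "M = real K * e"
  \<comment> \<open>Cauchy-Schwarz in the form t \<le> t^2 / (2M) + M / 2.\<close>
  have M0: "0 < M" using K0 e(1) by (simp add: M_def)
  have "M = (\<Sum>i<K. e)" by (simp add: M_def)
  also have "\<dots> \<le> (\<Sum>i<K. norm (a (n i)))"
    by (rule sum_mono) (use r(2) in \<open>auto simp: n_def B_def\<close>)
  also have "\<dots> = norm (\<Sum>i<K. s i * a (n i))"
    by (simp add: s(1) flip: of_real_sum) (simp add: sum_nonneg)
  also have "(\<Sum>i<K. s i * a (n i)) = (\<integral>p. G p * V (fst p) \<partial>\<mu>)"
    unfolding a_def V_def sum_distrib_left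
    by (subst Bochner_Integration.integral_sum) (auto simp: mult.left_commute[of "G _"] intGu)
  also have "norm \<dots> \<le> (\<integral>p. (norm (V (fst p)))\<^sup>2 * (1 / (2 * M)) + M / 2 \<partial>\<mu>)"
  proof (rule Bochner_Integration.integral_norm_bound_integral)
    have "norm (G p * V (fst p)) \<le> real K" for p
      unfolding norm_mult using mult_mono[OF G(2) nV, of "fst p" p] by simp
    then show "integrable \<mu> (\<lambda>p. G p * V (fst p))"
      by (intro integrableI[of _ "real K"] continuous_on_mult G cont_fst cV)
    have "integrable \<mu> (\<lambda>p. (norm (V (fst p)))\<^sup>2)"
      by (rule integrableI[of _ "(real K)\<^sup>2"]) (auto intro: cont_fst[OF cV2] power_mono nV)
    then show "integrable \<mu> (\<lambda>p. (norm (V (fst p)))\<^sup>2 * (1 / (2 * M)) + M / 2)"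
      by (intro Bochner_Integration.integrable_add integrable_mult_left) auto
    show "norm (G p * V (fst p)) \<le> (norm (V (fst p)))\<^sup>2 * (1 / (2 * M)) + M / 2" for p
    proof -
      have "norm (G p * V (fst p)) \<le> norm (V (fst p))"
        unfolding norm_mult using mult_right_mono[OF G(2), of "norm (V (fst p))" p] by simp
      also have "\<dots> \<le> (norm (V (fst p)))\<^sup>2 * (1 / (2 * M)) + M / 2"
        using zero_le_power2[of "norm (V (fst p)) - M"] M0
        by (simp add: power2_diff field_simps power2_eq_square)
      finally show ?thesis .
    qed
  qed
  also have "\<dots> = integral {0..1} (\<lambda>x. (norm (V x))\<^sup>2 * (1 / (2 * M)) + M / 2)"
    by (rule integral_fst_marginal[OF borel proj])
       (intro circle_continuousD circle_continuous_add circle_continuous_mult cV2 circle_continuous_const)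
  also have "\<dots> = integral {0..1} (\<lambda>x. (norm (V x))\<^sup>2) * (1 / (2 * M)) + M / 2"
    by (subst Henstock_Kurzweil_Integration.integral_add)
       (auto intro!: circle_continuous_integrable circle_continuous_mult cV2 simp del: times_divide_eq_right mult_1_right)
  finally have "M / 2 \<le> integral {0..1} (\<lambda>x. (norm (V x))\<^sup>2) * (1 / (2 * M))" by simp
  \<comment> \<open>M / 2 was absorbed on the left; multiplication by 2 M leaves the Cauchy-Schwarz
    bound.\<close>
  then have M_le: "M\<^sup>2 \<le> integral {0..1} (\<lambda>x. (norm (V x))\<^sup>2)"
    using M0 by (simp add: field_simps power2_eq_square)
  \<comment> \<open>The Gram matrix of the chosen functions. Off the diagonal its entries are
    \<open>c m\<close> or their conjugates with m \<ge> g0, hence smaller than e^2 / 4.\<close>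
  define \<gamma> where "\<gamma> = (\<lambda>i j. integral {0..1} (\<lambda>x. u (n i) x * cnj (u (n j) x)))"
  have ccnj: "circle_continuous (\<lambda>x. cnj (u m x))" for m
    by (rule circle_continuous_compose[OF cu]) (intro continuous_intros)
  have cuu: "circle_continuous (\<lambda>x. u m x * cnj (u m' x))" for m m'
    by (intro circle_continuous_mult cu ccnj)
  have \<gamma>_le: "norm (\<gamma> i j) \<le> (if i = j then 1 else 0) + e\<^sup>2 / 4" for i j
  proof -
    consider "i = j" | "i < j" | "j < i" by linarith
    then show ?thesis
    proof cases
      case 1
      have "norm (\<gamma> i i) \<le> integral {0..1} (\<lambda>x::real. 1::real)"
        unfolding \<gamma>_def by (intro norm_integral_circle_le cuu circle_continuous_const) (simp add: norm_mult nu)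
      moreover have "integral {0..1} (\<lambda>x::real. 1::real) = 1" by simp
      moreover have "0 \<le> e\<^sup>2 / 4" by simp
      ultimately have "norm (\<gamma> i i) \<le> 1 + e\<^sup>2 / 4" by linarith
      then show ?thesis using 1 by simp
    next
      case 2
      then obtain m where m: "m \<ge> g0" "n j = n i + m" using gap by blast
      have "\<gamma> i j = cnj (c m)"
        unfolding corr[of "n i" m, symmetric] integral_cnj \<gamma>_def m(2) by (simp add: mult.commute)
      then show ?thesis using g0[OF m(1)] 2 by simp
    next
      case 3
      then obtain m where m: "m \<ge> g0" "n i = n j + m" using gap by blast
      have "\<gamma> i j = c m"
        unfolding \<gamma>_def m(2) by (rule corr)
      then show ?thesis using g0[OF m(1)] 3 by simp
    qed
  qed
  have "of_real (integral {0..1} (\<lambda>x. (norm (V x))\<^sup>2)) = integral {0..1} (\<lambda>x. V x * cnj (V x))"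
  proof -
    have "complex_of_real (integral {0..1} (\<lambda>x. (norm (V x))\<^sup>2)) = integral {0..1} (\<lambda>x. complex_of_real ((norm (V x))\<^sup>2))"
      using integral_linear[OF circle_continuous_integrable[OF cV2, of 0 1] bounded_linear_of_real[where 'a = complex]]
      by (simp add: o_def)
    then show ?thesis by (simp only: complex_norm_square)
  qed
  also have "(\<lambda>x. V x * cnj (V x)) = (\<lambda>x. \<Sum>i<K. \<Sum>j<K. (s i * cnj (s j)) * (u (n i) x * cnj (u (n j) x)))"
    by (simp add: V_def sum_product mult_ac)
  also have "integral {0..1} \<dots> = (\<Sum>i<K. \<Sum>j<K. (s i * cnj (s j)) * \<gamma> i j)"
    unfolding \<gamma>_def
    by (simp add: Henstock_Kurzweil_Integration.integral_sum circle_continuous_integrable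
        circle_continuous_sum circle_continuous_mult cuu del: mult.assoc)
  finally have "norm (of_real (integral {0..1} (\<lambda>x. (norm (V x))\<^sup>2)) :: complex) =
      norm (\<Sum>i<K. \<Sum>j<K. (s i * cnj (s j)) * \<gamma> i j)" by simp
  also have "\<dots> \<le> (\<Sum>i<K. \<Sum>j<K. (if i = j then 1 else 0) + e\<^sup>2 / 4)"
  proof (intro sum_norm_le)
    fix i j
    have "norm (s i * cnj (s j) * \<gamma> i j) = (norm (s i) * norm (s j)) * norm (\<gamma> i j)"
      by (simp add: norm_mult)
    also have "\<dots> \<le> (1 * 1) * norm (\<gamma> i j)"
      by (intro mult_right_mono mult_mono s) auto
    finally show "norm (s i * cnj (s j) * \<gamma> i j) \<le> (if i = j then 1 else 0) + e\<^sup>2 / 4"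
      using \<gamma>_le[of i j] by simp
  qed
  also have "\<dots> = real K + (real K)\<^sup>2 * (e\<^sup>2 / 4)"
    by (simp add: sum.distrib power2_eq_square algebra_simps)
  finally have "M\<^sup>2 \<le> real K + (real K)\<^sup>2 * (e\<^sup>2 / 4)"
    using M_le by simp
  \<comment> \<open>By the choice of K, the diagonal contribution K is less than K^2 e^2 / 2, so the
    whole bound is below 3/4 of M^2.\<close>
  moreover have "real K * 2 < real K * (real K * e\<^sup>2)"
    using K K0 e(1) by (intro mult_strict_left_mono) (auto simp: field_simps)
  ultimately have "(real K)\<^sup>2 * e\<^sup>2 < (real K)\<^sup>2 * e\<^sup>2 * (3 / 4)"
    by (simp add: M_def power_mult_distrib power2_eq_square algebra_simps)
  moreover have "0 \<le> (real K)\<^sup>2 * e\<^sup>2" by simp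
  ultimately show False by linarith
qed

section \<open>The skew product\<close>

lemma tdist_le: "tdist x y \<le> \<bar>x - y\<bar>"
  using round_diff_minimal[of "x - y" 0] by (simp add: tdist_def)

lemma tdist_nonneg: "0 \<le> tdist x y"
  by (simp add: tdist_def)

lemma tdist_eq_0_iff: "tdist x y = 0 \<longleftrightarrow> x - y \<in> \<int>"
proof
  assume "tdist x y = 0"
  then have "x - y = of_int (round (x - y))" by (simp add: tdist_def)
  then show "x - y \<in> \<int>" by (metis Ints_of_int)
qed (auto simp: tdist_def elim!: Ints_cases)

text \<open>Points at torus distance 0 have images at torus distance 0, so \<open>f\<close> is well
  defined modulo 1.\<close>

lemma circle_lipschitz_cong:
  assumes "circle_lipschitz f" "x - y \<in> \<int>"
  shows "f x - f y \<in> \<int>"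
proof -
  obtain L where "\<And>x y. tdist (f x) (f y) \<le> L * tdist x y"
    using assms(1) by (auto simp: circle_lipschitz_def)
  from this[of x y] assms(2) have "tdist (f x) (f y) = 0"
    using tdist_nonneg[of "f x" "f y"] tdist_eq_0_iff[of x y] by simp
  then show ?thesis by (simp add: tdist_eq_0_iff)
qed

text \<open>A difference of lifts below 1/2 is already the representative nearest to 0; subtracting
  a nonzero integer would leave more than 1/2.\<close>

lemma lift_diff_le_tdist:
  assumes "F x - f x \<in> \<int>" "F y - f y \<in> \<int>" and small: "\<bar>F x - F y\<bar> < 1 / 2"
  shows "\<bar>F x - F y\<bar> \<le> tdist (f x) (f y)"
proof -
  obtain k m where k: "F x - f x = of_int k" and m: "F y - f y = of_int m"
    using assms by (auto elim!: Ints_cases)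
  define j where "j = k - m + round (f x - f y)"
  have t: "tdist (f x) (f y) = \<bar>(F x - F y) - of_int j\<bar>"
    using k m by (auto simp: tdist_def j_def)
  show ?thesis
  proof (cases "j = 0")
    case True
    then show ?thesis using t by simp
  next
    case False
    then have "1 \<le> \<bar>real_of_int j\<bar>" by linarith
    then show ?thesis using t small by linarith
  qed
qed

text \<open>By uniform continuity the interval splits into steps on which the lift moves by less
  than 1/2. There it inherits the torus estimate, and the steps are summed. The modulus of
  \<open>L\<close> saves a proof that L \<ge> 0.\<close>

lemma lift_lipschitz:
  assumes cont: "continuous_on UNIV F" and lift: "\<And>x. F x - f x \<in> \<int>"
    and lip: "\<And>x y. tdist (f x) (f y) \<le> L * tdist x y"
  shows "\<bar>F x - F y\<bar> \<le> \<bar>L\<bar> * \<bar>x - y\<bar>"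
proof -
  have wlog: "\<bar>F y - F x\<bar> \<le> \<bar>L\<bar> * (y - x)" if "x < y" for x y
  proof -
    have "uniformly_continuous_on {x..y} F"
      using cont by (intro compact_uniformly_continuous) (auto intro: continuous_on_subset)
    then obtain \<delta> where "0 < \<delta>" and
      \<delta>: "\<And>s t. s \<in> {x..y} \<Longrightarrow> t \<in> {x..y} \<Longrightarrow> dist s t < \<delta> \<Longrightarrow> dist (F s) (F t) < 1 / 2"
      unfolding uniformly_continuous_on_def by (metis half_gt_zero zero_less_one)
    obtain N :: nat where N: "(y - x) / \<delta> < real N" using reals_Archimedean2 by blast
    have N0: "0 < real N" using N \<open>0 < \<delta>\<close> that by (smt (verit) divide_pos_pos)
    define h where "h = (y - x) / real N"
    have h: "0 < h" "h < \<delta>" using N N0 that \<open>0 < \<delta>\<close> by (auto simp: h_def field_simps)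
    have Nh: "real N * h = y - x" using N0 by (simp add: h_def)
    have step: "\<bar>F (x + real (Suc i) * h) - F (x + real i * h)\<bar> \<le> \<bar>L\<bar> * h" if "i < N" for i
    proof -
      have "real (Suc i) * h \<le> real N * h" using that h by (intro mult_right_mono) auto
      then have in1: "x + real (Suc i) * h \<in> {x..y}" using Nh h by auto
      have "real i * h \<le> real N * h" using that h by (intro mult_right_mono) auto
      then have in2: "x + real i * h \<in> {x..y}" using Nh h by auto
      have diff: "x + real (Suc i) * h - (x + real i * h) = h" by (simp add: algebra_simps)
      have "\<bar>F (x + real (Suc i) * h) - F (x + real i * h)\<bar> < 1 / 2"
        using \<delta>[OF in1 in2] h diff by (simp add: dist_real_def)
      then have "\<bar>F (x + real (Suc i) * h) - F (x + real i * h)\<bar> \<le> tdist (f (x + real (Suc i) * h)) (f (x + real i * h))"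
        by (intro lift_diff_le_tdist lift)
      also have "\<dots> \<le> L * tdist (x + real (Suc i) * h) (x + real i * h)" by (rule lip)
      also have "\<dots> \<le> \<bar>L\<bar> * tdist (x + real (Suc i) * h) (x + real i * h)"
        by (intro mult_right_mono tdist_nonneg) simp
      also have "\<dots> \<le> \<bar>L\<bar> * h"
        using tdist_le[of "x + real (Suc i) * h" "x + real i * h"] h diff by (intro mult_left_mono) auto
      finally show ?thesis .
    qed
    have "F y - F x = (\<Sum>i<N. F (x + real (Suc i) * h) - F (x + real i * h))"
      using sum_lessThan_telescope[of "\<lambda>i. F (x + real i * h)" N] Nh by simp
    also have "\<bar>\<dots>\<bar> \<le> (\<Sum>i<N. \<bar>L\<bar> * h)"
      by (intro order_trans[OF sum_abs sum_mono] step) simp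
    also have "\<dots> = \<bar>L\<bar> * (y - x)" by (simp add: Nh[symmetric])
    finally show ?thesis .
  qed
  consider "x < y" | "x = y" | "y < x" by linarith
  then show ?thesis
    using wlog[of x y] wlog[of y x] by cases (auto simp: abs_minus_commute)
qed

text \<open>The degree fixes F (x + 1) - F x at x = 0 only; this difference is continuous and
  integer valued, hence constant.\<close>

lemma lipschitz_lift_exists:
  assumes lip: "circle_lipschitz f" and deg: "circle_degree f d"
  obtains F L where "lipschitz_lift F L d" "\<And>x. F x - f x \<in> \<int>"
proof -
  obtain L where L: "\<And>x y. tdist (f x) (f y) \<le> L * tdist x y"
    using lip by (auto simp: circle_lipschitz_def)
  obtain F where F: "continuous_on UNIV F" "\<And>x. F x - f x \<in> \<int>" "F 1 - F 0 = of_int d"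
    using deg by (auto simp: circle_degree_def)
  have int: "F (x + 1) - F x \<in> \<int>" for x
  proof -
    have "F (x + 1) - F x = (F (x + 1) - f (x + 1)) - (F x - f x) + (f (x + 1) - f x)" by simp
    also have "\<dots> \<in> \<int>"
      using circle_lipschitz_cong[OF lip, of "x + 1" x] by (intro Ints_add[OF Ints_diff[OF F(2) F(2)]]) simp
    finally show ?thesis .
  qed
  have "(\<lambda>x. F (x + 1) - F x) constant_on UNIV"
  proof (rule continuous_discrete_range_constant)
    show "continuous_on UNIV (\<lambda>x. F (x + 1) - F x)"
      by (intro continuous_intros continuous_on_compose2[OF F(1)] F(1)) auto
    show "\<exists>e>0. \<forall>y. y \<in> UNIV \<and> F (y + 1) - F y \<noteq> F (x + 1) - F x \<longrightarrow>
        e \<le> norm (F (y + 1) - F y - (F (x + 1) - F x))" for x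
    proof (intro exI[of _ 1] conjI allI impI)
      fix y assume "y \<in> UNIV \<and> F (y + 1) - F y \<noteq> F (x + 1) - F x"
      then show "1 \<le> norm (F (y + 1) - F y - (F (x + 1) - F x))"
        using int[of y] int[of x] by (intro Ints_nonzero_abs_ge1[of "F (y + 1) - F y - (F (x + 1) - F x)", folded real_norm_def]) auto
    qed simp
  qed simp
  then obtain b where b: "\<And>x. F (x + 1) - F x = b" unfolding constant_on_def by auto
  have "b = of_int d" using b[of 0] F(3) by simp
  then have "lipschitz_lift F \<bar>L\<bar> d"
    using b lift_lipschitz[OF F(1,2) L] by unfold_locales (auto simp: algebra_simps)
  then show thesis using F(2) by (rule that)
qed

text \<open>The skew product reduces to the unit square at every step, so the unreduced formula is
  its iterate only modulo integers, which suffices for periodic test functions.\<close>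

lemma (in lipschitz_lift) skew_funpow:
  assumes lipf: "circle_lipschitz f" and lift: "\<And>x. F x - f x \<in> \<int>"
  shows "fst ((skew \<alpha> f ^^ n) p) - (fst p + of_nat n * \<alpha>) \<in> \<int> \<and>
         snd ((skew \<alpha> f ^^ n) p) - (snd p + birkhoff \<alpha> n (fst p)) \<in> \<int>"
proof (induction n)
  case 0
  then show ?case by (simp add: birkhoff_def)
next
  case (Suc n)
  define q where "q = (skew \<alpha> f ^^ n) p"
  define x where "x = fst p + of_nat n * \<alpha>"
  have 1: "fst q - x \<in> \<int>" and 2: "snd q - (snd p + birkhoff \<alpha> n (fst p)) \<in> \<int>"
    using Suc by (auto simp: q_def x_def)
  have "frac (fst q + \<alpha>) - (fst p + of_nat (Suc n) * \<alpha>) = (fst q - x) - of_int \<lfloor>fst q + \<alpha>\<rfloor>"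
    by (simp add: frac_def x_def algebra_simps)
  also have "\<dots> \<in> \<int>" using 1 by (rule Ints_diff) simp
  finally have A: "frac (fst q + \<alpha>) - (fst p + of_nat (Suc n) * \<alpha>) \<in> \<int>" .
  \<comment> \<open>The integers come from the induction hypothesis, from evaluating
    \<open>f\<close> at the reduced base point, from replacing \<open>f\<close> by its lift, and
    from the final reduction.\<close>
  have "frac (snd q + f (fst q)) - (snd p + birkhoff \<alpha> (Suc n) (fst p)) =
     (snd q - (snd p + birkhoff \<alpha> n (fst p))) + (f (fst q) - f x) - (F x - f x) - of_int \<lfloor>snd q + f (fst q)\<rfloor>"
    by (simp add: frac_def x_def birkhoff_def algebra_simps)
  also have "\<dots> \<in> \<int>"
    by (rule Ints_diff[OF Ints_diff[OF Ints_add[OF 2 circle_lipschitz_cong[OF lipf 1]] lift]]) simp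
  finally have B: "frac (snd q + f (fst q)) - (snd p + birkhoff \<alpha> (Suc n) (fst p)) \<in> \<int>" .
  have "(skew \<alpha> f ^^ Suc n) p = (frac (fst q + \<alpha>), frac (snd q + f (fst q)))"
    unfolding q_def funpow.simps o_def by (rule skew_def)
  with A B show ?case by (simp del: of_nat_Suc)
qed

section \<open>Integration over the unit square\<close>

lemma integral_unit_square:
  fixes \<phi> :: "real \<times> real \<Rightarrow> 'a::euclidean_space"
  assumes "continuous_on UNIV \<phi>"
  shows "(\<integral>p. \<phi> p \<partial>(lebesgue_on ({0..<1} \<times> {0..<1}))) = integral (cbox (0, 0) (1, 1)) \<phi>"
proof -
  let ?Q = "{0..<1::real} \<times> {0..<1::real}"
  have "?Q \<in> sets borel" by (simp add: borel_prod[symmetric])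
  then have Q: "?Q \<in> sets lebesgue" by simp
  have sub: "?Q \<subseteq> cbox (0, 0) (1, 1)" "box (0, 0) (1, 1) \<subseteq> ?Q"
    by (auto simp: box_def Basis_prod_def)
  have "\<phi> absolutely_integrable_on cbox (0, 0) (1, 1)"
    using assms by (intro absolutely_integrable_continuous) (auto intro: continuous_on_subset)
  then have abs: "\<phi> absolutely_integrable_on ?Q"
    by (rule set_integrable_subset) (use Q sub in auto)
  have "(\<integral>p. \<phi> p \<partial>(lebesgue_on ?Q)) = set_lebesgue_integral lebesgue ?Q \<phi>"
    unfolding set_lebesgue_integral_def using Q by (intro integral_restrict_space) simp
  also have "\<dots> = integral ?Q \<phi>"
    by (rule set_lebesgue_integral_eq_integral[OF abs])
  also have "\<dots> = integral (cbox (0, 0) (1, 1)) \<phi>"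
  \<comment> \<open>The half-open and the closed square differ inside the frontier, a null
    set.\<close>
  proof (rule integral_spike_set)
    have "negligible (cbox (0::real, 0::real) (1, 1) - box (0, 0) (1, 1))"
      by (rule negligible_frontier_interval)
    then show "negligible {x \<in> ?Q - cbox (0, 0) (1, 1). \<phi> x \<noteq> 0}"
      "negligible {x \<in> cbox (0, 0) (1, 1) - ?Q. \<phi> x \<noteq> 0}"
      by (rule negligible_subset; use sub in auto)+
  qed
  finally show ?thesis .
qed

lemma integral_torus_char:
  "integral (cbox (0, 0) (1, 1)) (torus_char j l) = (if j = 0 \<and> l = 0 then 1 else 0)"
proof -
  have "integral (cbox (0, 0) (1, 1)) (torus_char j l) =
    integral (cbox 0 1) (\<lambda>x. integral (cbox 0 1) (\<lambda>y. torus_char j l (x, y)))"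
    by (rule integral_prod_continuous) (intro continuous_intros)
  also have "\<dots> = integral {0..1} (\<lambda>x. circ (of_int j * x)) * integral {0..1} (\<lambda>y. circ (of_int l * y))"
    by (simp add: torus_char_split)
  also have "\<dots> = (if j = 0 \<and> l = 0 then 1 else 0)"
    using integral_circ[of j] integral_circ[of l] by auto
  finally show ?thesis .
qed

text \<open>For l = 0 only the first coordinate is involved and the marginal decides. For l \<noteq>
  0 the exponentials e(lS) have decaying stationary correlations, so they tend weakly to 0 against
  the fixed character.\<close>

theorem (in lipschitz_lift) expectation_torus_char_tendsto:
  assumes irr: "\<alpha> \<notin> \<rat>" and "d \<noteq> 0"
    and prob: "prob_space \<mu>"
    and borel: "sets \<mu> = sets borel"
    and proj: "distr \<mu> lborel fst = density lborel (indicator {0..<1})"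
  shows "(\<lambda>n. \<integral>p. torus_char j l (fst p + of_nat n * \<alpha>, snd p + birkhoff \<alpha> n (fst p)) \<partial>\<mu>)
     \<longlonglongrightarrow> integral (cbox (0, 0) (1, 1)) (torus_char j l)"
proof -
  interpret prob_space \<mu> by fact
  have eq: "(\<integral>p. torus_char j l (fst p + of_nat n * \<alpha>, snd p + birkhoff \<alpha> n (fst p)) \<partial>\<mu>) =
     circ (of_int j * (of_nat n * \<alpha>)) * (\<integral>p. torus_char j l p * circ (of_int l * birkhoff \<alpha> n (fst p)) \<partial>\<mu>)" for n
    by (subst integral_mult_right_zero[symmetric]) (simp add: torus_char_def distrib_left circ_add mult_ac)
  consider "j = 0" "l = 0" | "j \<noteq> 0" "l = 0" | "l \<noteq> 0" by blast
  then show ?thesis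
  proof cases
    case 1
    then show ?thesis unfolding integral_torus_char by (simp add: torus_char_def prob_space)
  next
    case 2
    have "(\<integral>p. torus_char j l p * circ (of_int l * birkhoff \<alpha> n (fst p)) \<partial>\<mu>) = 0" for n
    proof -
      have "(\<integral>p. torus_char j l p * circ (of_int l * birkhoff \<alpha> n (fst p)) \<partial>\<mu>) = (\<integral>p. circ (of_int j * fst p) \<partial>\<mu>)"
        using 2 by (simp add: torus_char_def)
      also have "\<dots> = integral {0..1} (\<lambda>x. circ (of_int j * x))"
        by (rule integral_fst_marginal[OF borel proj]) (intro continuous_intros)
      finally show ?thesis using integral_circ 2 by simp
    qed
    then show ?thesis unfolding integral_torus_char eq using 2 by simp
  next
    case 3
    have "(\<lambda>n. \<integral>p. torus_char j l p * circ (of_int l * birkhoff \<alpha> n (fst p)) \<partial>\<mu>) \<longlonglongrightarrow> 0"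
    proof (rule mixing_imp_weak_null[OF prob borel proj])
      show "integral {0..1} (\<lambda>x. circ (of_int l * birkhoff \<alpha> (n + m) x) * cnj (circ (of_int l * birkhoff \<alpha> n x))) =
          integral {0..1} (\<lambda>x. circ (of_int l * birkhoff \<alpha> m x))" for n m
      proof -
        have "circ (of_int l * birkhoff \<alpha> (n + m) x) * cnj (circ (of_int l * birkhoff \<alpha> n x)) =
           circ (of_int l * birkhoff \<alpha> m (x + of_nat n * \<alpha>))" for x
          unfolding cnj_circ circ_add[symmetric] birkhoff_diff[symmetric] by (simp add: algebra_simps)
        then show ?thesis using integral_circle_shift[OF circle_continuous_circ_birkhoff] by simp
      qed
      show "(\<lambda>m. integral {0..1} (\<lambda>x. circ (of_int l * birkhoff \<alpha> m x))) \<longlonglongrightarrow> 0"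
        by (rule integral_circ_birkhoff_tendsto_0[OF irr \<open>d \<noteq> 0\<close> 3])
      show "continuous_on UNIV (torus_char j l)" by (intro continuous_intros)
    qed (auto intro: circle_continuous_circ_birkhoff)
    \<comment> \<open>The scalar e(j n \<alpha>) in front does not converge in general, but it has
      modulus 1, so the argument passes to norms.\<close>
    then have "(\<lambda>n. norm (\<integral>p. torus_char j l p * circ (of_int l * birkhoff \<alpha> n (fst p)) \<partial>\<mu>)) \<longlonglongrightarrow> 0"
      by (rule tendsto_norm_zero)
    then have "(\<lambda>n. \<integral>p. torus_char j l (fst p + of_nat n * \<alpha>, snd p + birkhoff \<alpha> n (fst p)) \<partial>\<mu>) \<longlonglongrightarrow> 0"
      unfolding eq by (subst tendsto_norm_zero_iff[symmetric]) (simp add: norm_mult)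
    then show ?thesis unfolding integral_torus_char using 3 by simp
  qed
qed

theorem theorem1p5:
  fixes \<alpha> :: real and f :: "real \<Rightarrow> real" and \<mu> :: "(real \<times> real) measure"
    and \<phi> :: "real \<times> real \<Rightarrow> real"
  assumes irr: "\<alpha> \<notin> \<rat>"
    and lip: "circle_lipschitz f"
    and deg: "homotopically_nontrivial f"
    and prob: "prob_space \<mu>"
    and borel: "sets \<mu> = sets borel"
    and supp: "emeasure \<mu> ({0..<1} \<times> {0..<1}) = 1"
    and proj: "distr \<mu> lborel fst = density lborel (indicator {0..<1})"
    and cont: "torus_continuous \<phi>"
  shows "(\<lambda>n. \<integral>p. \<phi> ((skew \<alpha> f ^^ n) p) \<partial>\<mu>)
           \<longlonglongrightarrow> (\<integral>p. \<phi> p \<partial>(lebesgue_on ({0..<1} \<times> {0..<1})))"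
proof -
  interpret prob_space \<mu> by fact
  obtain d where d: "d \<noteq> 0" "circle_degree f d"
    using deg by (auto simp: homotopically_nontrivial_def)
  obtain F L where "lipschitz_lift F L d" and F: "\<And>x. F x - f x \<in> \<int>"
    using lipschitz_lift_exists[OF lip d(2)] by blast
  then interpret lipschitz_lift F L d by simp
  \<comment> \<open>The iterate without reduction modulo 1: unlike the reduced one it is continuous,
    which gives integrability.\<close>
  define T where "T = (\<lambda>n p. (fst p + of_nat n * \<alpha>, snd p + birkhoff \<alpha> n (fst p)))"
  define Q where "Q = cbox (0::real, 0::real) (1, 1)"
  have contT: "continuous_on UNIV (\<lambda>p. \<psi> (T n p))" if "continuous_on UNIV \<psi>"
    for \<psi> :: "real \<times> real \<Rightarrow> 'b::euclidean_space" and n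
    unfolding T_def
    by (rule continuous_on_compose2[OF that])
       (auto intro!: continuous_intros continuous_on_compose2[OF continuous_birkhoff[of UNIV]])
  note integrable = integrable_bounded_continuous[OF prob borel]
  have integrableQ: "\<psi> integrable_on Q" if "continuous_on UNIV \<psi>" for \<psi> :: "real \<times> real \<Rightarrow> 'b::euclidean_space"
    unfolding Q_def using that by (intro integrable_continuous) (auto intro: continuous_on_subset)
  \<comment> \<open>Continuity and boundedness are carried along so that all integrals exist in the
    sum and limit cases.\<close>
  define P where "P = (\<lambda>\<psi>::real \<times> real \<Rightarrow> real. continuous_on UNIV \<psi> \<and> (\<exists>C. \<forall>p. norm (\<psi> p) \<le> C) \<and>
     (\<lambda>n. \<integral>p. \<psi> (T n p) \<partial>\<mu>) \<longlonglongrightarrow> integral Q \<psi>)"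
  from cont have "P \<phi>"
  proof (induction rule: torus_continuous_induct)
    case (char c j l)
    have cc: "continuous_on UNIV (\<lambda>p. c * torus_char j l p)" by (intro continuous_intros)
    have cont: "continuous_on UNIV (\<lambda>p. Re (c * torus_char j l p))" by (intro continuous_intros)
    moreover have "\<forall>p. norm (Re (c * torus_char j l p)) \<le> norm c"
    proof
      fix p
      show "norm (Re (c * torus_char j l p)) \<le> norm c"
        using abs_Re_le_cmod[of "c * torus_char j l p"] unfolding norm_mult real_norm_def by simp
    qed
    moreover have "(\<lambda>n. \<integral>p. Re (c * torus_char j l (T n p)) \<partial>\<mu>) \<longlonglongrightarrow> integral Q (\<lambda>p. Re (c * torus_char j l p))"
    proof -
      have "(\<lambda>n. \<integral>p. torus_char j l (T n p) \<partial>\<mu>) \<longlonglongrightarrow> integral Q (torus_char j l)"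
        unfolding T_def Q_def by (rule expectation_torus_char_tendsto[OF irr d(1) prob borel proj])
      then have "(\<lambda>n. Re (c * (\<integral>p. torus_char j l (T n p) \<partial>\<mu>))) \<longlonglongrightarrow> Re (c * integral Q (torus_char j l))"
        by (intro tendsto_intros)
      moreover have "Re (c * (\<integral>p. torus_char j l (T n p) \<partial>\<mu>)) = (\<integral>p. Re (c * torus_char j l (T n p)) \<partial>\<mu>)" for n
      proof -
        have "integrable \<mu> (\<lambda>p. c * torus_char j l (T n p))"
          by (rule integrable[OF contT[OF cc], of _ "norm c"]) (simp add: norm_mult)
        from integral_Re[OF this] show ?thesis by simp
      qed
      moreover have "Re (c * integral Q (torus_char j l)) = integral Q (\<lambda>p. Re (c * torus_char j l p))"
        using integral_linear[OF integrableQ[OF cc] bounded_linear_Re] by (simp add: o_def)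
      ultimately show ?thesis by (simp only:)
    qed
    ultimately show ?case unfolding P_def by blast
  next
    case (add g h)
    obtain C1 where g: "continuous_on UNIV g" "\<And>p. norm (g p) \<le> C1"
      "(\<lambda>n. \<integral>p. g (T n p) \<partial>\<mu>) \<longlonglongrightarrow> integral Q g" using add(1) unfolding P_def by blast
    obtain C2 where h: "continuous_on UNIV h" "\<And>p. norm (h p) \<le> C2"
      "(\<lambda>n. \<integral>p. h (T n p) \<partial>\<mu>) \<longlonglongrightarrow> integral Q h" using add(2) unfolding P_def by blast
    have "norm (g p + h p) \<le> C1 + C2" for p
      using g(2)[of p] h(2)[of p] norm_triangle_ineq[of "g p" "h p"] by linarith
    moreover have "(\<integral>p. g (T n p) + h (T n p) \<partial>\<mu>) = (\<integral>p. g (T n p) \<partial>\<mu>) + (\<integral>p. h (T n p) \<partial>\<mu>)" for n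
      by (intro Bochner_Integration.integral_add integrable[OF contT[OF g(1)] g(2)] integrable[OF contT[OF h(1)] h(2)])
    moreover have "integral Q (\<lambda>p. g p + h p) = integral Q g + integral Q h"
      by (intro Henstock_Kurzweil_Integration.integral_add integrableQ g h)
    ultimately show ?case unfolding P_def
      using tendsto_add[OF g(3) h(3)] continuous_on_add[OF g(1) h(1)] by auto
  next
    case (limit \<psi>)
    have cont: "continuous_on UNIV \<psi>" using limit(1) by (simp add: torus_continuous_def)
    \<comment> \<open>An approximant at distance 1 supplies a global bound for the limit
      function.\<close>
    obtain g1 C1 where g1: "\<And>p. \<bar>\<psi> p - g1 p\<bar> \<le> 1" "\<And>p. norm (g1 p) \<le> C1"
      using limit(2)[of 1] unfolding P_def by auto
    have bound: "norm (\<psi> p) \<le> C1 + 1" for p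
      using g1(1)[of p] g1(2)[of p] unfolding real_norm_def by linarith
    have "(\<lambda>n. \<integral>p. \<psi> (T n p) \<partial>\<mu>) \<longlonglongrightarrow> integral Q \<psi>"
    proof (rule LIMSEQ_I)
      fix e :: real assume "0 < e"
      obtain g where g: "P g" "\<And>p. \<bar>\<psi> p - g p\<bar> \<le> e / 4"
        using limit(2)[of "e / 4"] \<open>0 < e\<close> by auto
      obtain C where gc: "continuous_on UNIV g" "\<And>p. norm (g p) \<le> C"
        and lim: "(\<lambda>n. \<integral>p. g (T n p) \<partial>\<mu>) \<longlonglongrightarrow> integral Q g" using g(1) unfolding P_def by blast
      obtain N where N: "\<And>n. n \<ge> N \<Longrightarrow> norm ((\<integral>p. g (T n p) \<partial>\<mu>) - integral Q g) < e / 4"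
        using LIMSEQ_D[OF lim, of "e / 4"] \<open>0 < e\<close> by auto
      have 1: "\<bar>(\<integral>p. \<psi> (T n p) \<partial>\<mu>) - (\<integral>p. g (T n p) \<partial>\<mu>)\<bar> \<le> e / 4" for n
      proof -
        have "(\<integral>p. \<psi> (T n p) \<partial>\<mu>) - (\<integral>p. g (T n p) \<partial>\<mu>) = (\<integral>p. \<psi> (T n p) - g (T n p) \<partial>\<mu>)"
          by (intro Bochner_Integration.integral_diff[symmetric] integrable[OF contT[OF cont] bound]
             integrable[OF contT[OF gc(1)] gc(2)])
        also have "\<bar>\<dots>\<bar> \<le> (\<integral>p. e / 4 \<partial>\<mu>)"
          unfolding real_norm_def[symmetric]
          by (rule Bochner_Integration.integral_norm_bound_integral)
             (use g(2) in \<open>auto intro!: Bochner_Integration.integrable_diff integrable[OF contT[OF cont] bound]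
             integrable[OF contT[OF gc(1)] gc(2)]\<close>)
        finally show ?thesis by (simp add: prob_space)
      qed
      have "norm (integral Q (\<lambda>p. \<psi> p - g p)) \<le> integral Q (\<lambda>p. e / 4)"
        by (rule integral_norm_bound_integral)
          (use g(2) in \<open>auto intro!: integrableQ continuous_on_diff cont gc\<close>)
      also have "integral Q (\<lambda>p. e / 4) = e / 4" by (simp add: Q_def content_Pair)
      also have "integral Q (\<lambda>p. \<psi> p - g p) = integral Q \<psi> - integral Q g"
        by (intro Henstock_Kurzweil_Integration.integral_diff integrableQ cont gc)
      finally have 2: "\<bar>integral Q \<psi> - integral Q g\<bar> \<le> e / 4" by simp
      have "norm ((\<integral>p. \<psi> (T n p) \<partial>\<mu>) - integral Q \<psi>) < e" if "n \<ge> N" for n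
        using 1[of n] 2 N[OF that] \<open>0 < e\<close> unfolding real_norm_def by linarith
      then show "\<exists>no. \<forall>n\<ge>no. norm ((\<integral>p. \<psi> (T n p) \<partial>\<mu>) - integral Q \<psi>) < e" by blast
    qed
    then show ?case using cont bound unfolding P_def by blast
  qed
  \<comment> \<open>Replace the reduced iterate by \<open>T\<close>; periodicity of \<phi> absorbs
    the integers.\<close>
  moreover have "\<phi> ((skew \<alpha> f ^^ n) p) = \<phi> (T n p)" for n p
    using skew_funpow[OF assms(2) F, where \<alpha> = \<alpha> and n = n and p = p] by (intro torus_continuous_cong[OF cont]) (auto simp: T_def)
  moreover have "continuous_on UNIV \<phi>" using cont by (simp add: torus_continuous_def)
  ultimately show ?thesis by (simp add: P_def Q_def integral_unit_square)
qed

end
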